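(* Let $p,q\in(0,1)$ with $p<q$. Let $\mathcal{A}=(A_n)_{n\in\mathbb{Z}}$ be a Bernoulli point process of parameter $p$ on $\mathbb{Z}$ (each integer is a point independently with probability $p$), numbered increasingly with $A_0\le 0<A_1$. Let $s=(s_n)_{n\in\mathbb{Z}}$ be i.i.d. with $P\{s_n=k\}=(1-q)^{k-1}q$ for $k\in\{1,2,\dots\}$, independent of $\mathcal{A}$. Define $$D_n=\sup_{k\le n}\Big[A_k+\sum_{i=k}^n s_i\Big],\qquad r_n=\min(D_n,A_{n+1})-A_n,\qquad n\in\mathbb{Z}$$ (the $D_n$ are almost surely finite). Then the marked point process $(\mathcal{D},r)$, i.e. the random configuration $\{(D_n,r_n):n\in\mathbb{Z}\}$, has the same law as the marked point process $(\mathcal{A},s)$, i.e. the random configuration $\{(A_n,s_n):n\in\mathbb{Z}\}$.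
   Context: A marked point process is identified with its set of (point, mark) pairs; the numbering of points is irrelevant for its law. Interpretation: $D_n$ is the departure time of customer $n$ in the FIFO single-server queue with arrivals $A_n$ and services $s_n$; $r_n$ is the amount departing at slot $n+1$ in the dual storage model with supplies $s_n$ and requests $A_{n+1}-A_n$. *)

theory Defs
  imports "HOL-Probability.Probability"
begin

definition bernoulli_point_process :: "'a measure \<Rightarrow> real \<Rightarrow> ('a \<Rightarrow> int set) \<Rightarrow> bool" where
  "bernoulli_point_process M p X \<longleftrightarrow>
     prob_space.indep_events M (\<lambda>j. {\<omega> \<in> space M. j \<in> X \<omega>}) UNIV \<and>
     (\<forall>j. measure M {\<omega> \<in> space M. j \<in> X \<omega>} = p)"

text \<open>The supremum is taken in \<^typ>\<open>int\<close>, so it carries its intended meaning only when the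
  set over which it ranges is bounded above; otherwise it is an arbitrary fixed integer.\<close>

definition departure :: "(int \<Rightarrow> int) \<Rightarrow> (int \<Rightarrow> int) \<Rightarrow> int \<Rightarrow> int" where
  "departure a t n = (SUP k\<in>{..n}. a k + (\<Sum>i=k..n. t i))"

definition dual_departure :: "(int \<Rightarrow> int) \<Rightarrow> (int \<Rightarrow> int) \<Rightarrow> int \<Rightarrow> int" where
  "dual_departure a t n = min (departure a t n) (a (n + 1)) - a n"

definition configuration :: "(int \<Rightarrow> int) \<Rightarrow> (int \<Rightarrow> int) \<Rightarrow> (int \<times> int) set" where
  "configuration a t = {(a n, t n) | n. True}"

text \<open>Configurations carry the usual point process sigma-algebra, generated by the occupation
  of each site; since positions and marks are discrete, single sites suffice.\<close>

definition configuration_space :: "(int \<times> int) set measure" where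
  "configuration_space = sigma UNIV (range (\<lambda>x. {C. x \<in> C}))"

end

theory Submission
  imports Defs
begin

text \<open>
  Index time by customers. The sojourn times \<open>W\<^sub>n = D\<^sub>n - A\<^sub>n\<close> satisfy Lindley's recursion, and
  the map \<open>(W\<^sub>n, A\<^sub>n\<^sub>+\<^sub>1 - A\<^sub>n, s\<^sub>n\<^sub>+\<^sub>1) \<mapsto> (r\<^sub>n, D\<^sub>n\<^sub>+\<^sub>1 - D\<^sub>n, W\<^sub>n\<^sub>+\<^sub>1)\<close> is a bijection of
  \<open>\<int>\<^sup>3\<close> that preserves products of geometric weights with parameters \<open>(\<rho>, p, q)\<close> and
  \<open>(q, p, \<rho>)\<close>, where \<open>(1 - \<rho>)(1 - p) = 1 - q\<close>. Applying it customer by customer turns patterns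
  of inputs into patterns of outputs, as in Burke's theorem. The numbering of the departures is
  not the one of a point process seen from the origin, so probabilities are replaced throughout
  by expected numbers of indices \<open>n\<close> with a given property, which are invariant under
  renumbering; for the input these are computed from independence, and finite patterns between
  consecutive points determine the law of a configuration.
\<close>

section \<open>Geometric laws on the positive integers\<close>

text \<open>\<open>geometric_pmf\<close> counts failures and starts at 0, hence the shift by one.
  The values are integers because they are compared with differences of positions.\<close>

definition geo :: "real \<Rightarrow> int pmf" where
  "geo c = map_pmf (\<lambda>k. int k + 1) (geometric_pmf c)"

lemma pmf_geo:
  assumes "0 < c" "c \<le> 1"
  shows "pmf (geo c) k = (if 1 \<le> k then (1 - c) ^ nat (k - 1) * c else 0)"
proof (cases "1 \<le> k")
  case True
  have "inj (\<lambda>k. int k + 1)" by (auto simp: inj_def)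
  from pmf_map_inj'[OF this, of "geometric_pmf c" "nat (k - 1)"] True assms show ?thesis
    by (simp add: geo_def)
next
  case False
  then have "k \<notin> set_pmf (geo c)" by (auto simp: geo_def)
  then show ?thesis using False by (simp add: set_pmf_iff)
qed

lemma measure_geo_atLeast:
  assumes "0 < c" "c \<le> 1"
  shows "measure (geo c) {m..} = (1 - c) ^ nat (m - 1)"
proof -
  have low: "measure (geo c) {m..} = 1" if "m \<le> 1" for m
  proof -
    have "AE x in geo c. x \<in> {m..}"
      using that by (auto simp: AE_measure_pmf_iff geo_def)
    then show ?thesis
      by (simp add: measure_pmf.prob_eq_1)
  qed
  have "measure (geo c) {int n + 1..} = (1 - c) ^ n" for n
  proof (induction n)
    case 0
    then show ?case by (simp add: low)
  next
    case (Suc n)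
    have *: "{int n + 1..} = insert (int n + 1) {int (Suc n) + 1..}" by auto
    have "measure (geo c) {int n + 1..} = pmf (geo c) (int n + 1) + measure (geo c) {int (Suc n) + 1..}"
      unfolding * by (subst measure_pmf.finite_measure_Union[where A="{int n + 1}", simplified])
        (auto simp: measure_pmf_single)
    then show ?case using Suc assms by (simp add: pmf_geo algebra_simps)
  qed
  from this[of "nat (m - 1)"] show ?thesis
    using low[of m] by (cases "1 \<le> m") auto
qed

subsection \<open>Expected numbers of indices\<close>

definition expected_count :: "'a measure \<Rightarrow> (int \<Rightarrow> 'a \<Rightarrow> bool) \<Rightarrow> ennreal" where
  "expected_count M E = (\<integral>\<^sup>+ n. emeasure M {\<omega> \<in> space M. E n \<omega>} \<partial>count_space UNIV)"

lemma expected_count_cong_AE: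
  assumes "\<And>n. Measurable.pred M (E n)" "\<And>n. Measurable.pred M (F n)"
    and "AE \<omega> in M. \<forall>n. E n \<omega> \<longleftrightarrow> F n \<omega>"
  shows "expected_count M E = expected_count M F"
  unfolding expected_count_def
proof (intro nn_integral_cong emeasure_eq_AE)
  fix n
  show "AE \<omega> in M. (\<omega> \<in> {\<omega> \<in> space M. E n \<omega>}) = (\<omega> \<in> {\<omega> \<in> space M. F n \<omega>})"
    using assms(3) by eventually_elim auto
qed (use assms(1,2) in \<open>auto simp: pred_def\<close>)

lemma expected_count_cong:
  assumes "\<And>n \<omega>. \<omega> \<in> space M \<Longrightarrow> E n \<omega> \<longleftrightarrow> F n \<omega>"
  shows "expected_count M E = expected_count M F"
  unfolding expected_count_def using assms by (intro nn_integral_cong arg_cong[where f="emeasure M"]) auto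

text \<open>Translation permutes the indices, so the sum over all of them is unchanged. This lets a
  property of customer n + 1 be counted from customer n.\<close>

lemma expected_count_shift:
  "expected_count M (\<lambda>n. E (n + c)) = expected_count M E"
proof -
  have "bij_betw (\<lambda>n::int. n + c) UNIV UNIV"
    by (rule bij_betwI[where g="\<lambda>n. n - c"]) auto
  from nn_integral_bij_count_space[OF this, of "\<lambda>n. emeasure M {\<omega> \<in> space M. E n \<omega>}"]
  show ?thesis by (simp add: expected_count_def)
qed

lemma emeasure_partition:
  fixes f :: "'a \<Rightarrow> 'b::countable"
  assumes [measurable]: "Measurable.pred M E" "f \<in> M \<rightarrow>\<^sub>M count_space UNIV"
  shows "emeasure M {\<omega> \<in> space M. E \<omega>} =
    (\<integral>\<^sup>+ y. emeasure M {\<omega> \<in> space M. E \<omega> \<and> f \<omega> = y} \<partial>count_space UNIV)"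
proof -
  have "{\<omega> \<in> space M. E \<omega>} = (\<Union>y. {\<omega> \<in> space M. E \<omega> \<and> f \<omega> = y})" by auto
  also have "emeasure M \<dots> = (\<integral>\<^sup>+ y. emeasure M {\<omega> \<in> space M. E \<omega> \<and> f \<omega> = y} \<partial>count_space UNIV)"
    by (rule emeasure_UN_countable) (auto simp: disjoint_family_on_def)
  finally show ?thesis .
qed

text \<open>Countable additivity for each index, followed by an exchange of two nonnegative sums. It
  plays the role of conditioning on the value of \<open>f n\<close>.\<close>

lemma expected_count_partition:
  fixes f :: "int \<Rightarrow> 'a \<Rightarrow> 'b::countable"
  assumes [measurable]: "\<And>n. Measurable.pred M (E n)" "\<And>n. f n \<in> M \<rightarrow>\<^sub>M count_space UNIV"
  shows "expected_count M E =
    (\<integral>\<^sup>+ y. expected_count M (\<lambda>n \<omega>. E n \<omega> \<and> f n \<omega> = y) \<partial>count_space UNIV)"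
proof -
  have "emeasure M {\<omega> \<in> space M. E n \<omega>} =
    (\<integral>\<^sup>+ y. emeasure M {\<omega> \<in> space M. E n \<omega> \<and> f n \<omega> = y} \<partial>count_space UNIV)" for n
    by (rule emeasure_partition) measurable
  then show ?thesis
    unfolding expected_count_def
    by (subst nn_integral_count_space_nn_integral[symmetric]) simp_all
qed

text \<open>Monotone convergence twice: continuity from below of the measure at each index, then of
  the sum over the indices.\<close>

lemma expected_count_incseq:
  assumes [measurable]: "\<And>K n. Measurable.pred M (E K n)"
    and mono: "\<And>K n \<omega>. \<omega> \<in> space M \<Longrightarrow> E K n \<omega> \<Longrightarrow> E (Suc K) n \<omega>"
  shows "expected_count M (\<lambda>n \<omega>. \<exists>K. E K n \<omega>) = (SUP K. expected_count M (E K))"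
proof -
  have inc: "incseq (\<lambda>K. {\<omega> \<in> space M. E K n \<omega>})" for n
    by (rule incseq_SucI) (use mono in auto)
  have "emeasure M {\<omega> \<in> space M. \<exists>K. E K n \<omega>} = (SUP K. emeasure M {\<omega> \<in> space M. E K n \<omega>})" for n
  proof -
    have "{\<omega> \<in> space M. \<exists>K. E K n \<omega>} = (\<Union>K. {\<omega> \<in> space M. E K n \<omega>})" by auto
    then show ?thesis by (simp add: SUP_emeasure_incseq inc image_subset_iff)
  qed
  then show ?thesis
    unfolding expected_count_def
    by (simp only:) (rule nn_integral_monotone_convergence_SUP,
      auto simp: incseq_def le_fun_def intro!: emeasure_mono monoD[OF inc])
qed

text \<open>The bridge from counts back to probabilities: if the number of good indices is 0 or 1,
  its expectation is the probability that there is one.\<close>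

lemma expected_count_unique:
  assumes [measurable]: "\<And>n. Measurable.pred M (E n)"
    and uniq: "AE \<omega> in M. \<forall>n m. E n \<omega> \<longrightarrow> E m \<omega> \<longrightarrow> n = m"
  shows "expected_count M E = emeasure M {\<omega> \<in> space M. \<exists>n. E n \<omega>}"
proof -
  \<comment> \<open>Uniqueness is built into \<open>F\<close>, so that its events are disjoint
    everywhere and not only up to a null set.\<close>
  define F where "F n \<omega> \<longleftrightarrow> E n \<omega> \<and> (\<forall>m. E m \<omega> \<longrightarrow> m = n)" for n \<omega>
  have [measurable]: "Measurable.pred M (F n)" for n
    unfolding F_def by measurable
  have "expected_count M E = expected_count M F"
    by (rule expected_count_cong_AE) (use uniq in \<open>auto simp: F_def elim: eventually_mono\<close>)
  also have "\<dots> = emeasure M (\<Union>n. {\<omega> \<in> space M. F n \<omega>})"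
    unfolding expected_count_def
    by (rule emeasure_UN_countable[symmetric]) (auto simp: disjoint_family_on_def F_def)
  also have "\<dots> = emeasure M {\<omega> \<in> space M. \<exists>n. E n \<omega>}"
    by (rule emeasure_eq_AE) (use uniq in \<open>auto simp: F_def elim: eventually_mono\<close>)
  finally show ?thesis .
qed

section \<open>Finite patterns along a sequence\<close>

definition pattern :: "(int \<Rightarrow> 'b) \<Rightarrow> int \<Rightarrow> 'b list \<Rightarrow> bool" where
  "pattern z n l \<longleftrightarrow> (\<forall>i<length l. z (n + int i) = l ! i)"

lemma pattern_Nil [simp]: "pattern z n []"
  by (simp add: pattern_def)

lemma pattern_Cons [simp]: "pattern z n (x # l) \<longleftrightarrow> z n = x \<and> pattern z (n + 1) l"
  by (simp add: pattern_def All_less_Suc2 add.assoc)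

lemma pattern_append [simp]:
  "pattern z n (l @ l') \<longleftrightarrow> pattern z n l \<and> pattern z (n + int (length l)) l'"
  by (induction l arbitrary: n) (auto simp: algebra_simps)

lemma pattern_Pair:
  "pattern (\<lambda>n. (u n, v n)) n l \<longleftrightarrow> pattern u n (map fst l) \<and> pattern v n (map snd l)"
  by (induction l arbitrary: n) auto

text \<open>Reads the event as "the observed list equals l", so that the lists of a given length
  index a partition.\<close>

lemma pattern_iff_map:
  "pattern z n l \<longleftrightarrow> map (\<lambda>i. z (n + int i)) [0..<length l] = l"
  unfolding pattern_def list_eq_iff_nth_eq by simp

lemma measurable_pattern [measurable]:
  assumes [measurable]: "\<And>n. (\<lambda>\<omega>. z \<omega> n) \<in> M \<rightarrow>\<^sub>M count_space UNIV"
  shows "Measurable.pred M (\<lambda>\<omega>. pattern (z \<omega>) n l)"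
  unfolding pattern_def by measurable

lemma measurable_map_list [measurable]:
  fixes z :: "'a \<Rightarrow> 'c \<Rightarrow> 'b::countable"
  assumes [measurable]: "\<And>i. (\<lambda>\<omega>. z \<omega> i) \<in> M \<rightarrow>\<^sub>M count_space UNIV"
  shows "(\<lambda>\<omega>. map (z \<omega>) is) \<in> M \<rightarrow>\<^sub>M count_space UNIV"
proof (induction "is")
  case (Cons i "is")
  note Cons[measurable]
  show ?case by simp
qed simp

subsection \<open>Departure times\<close>

text \<open>The supremum defining the departure time, restricted to the last \<open>K + 1\<close> customers.\<close>

fun partial_departure :: "(int \<Rightarrow> int) \<Rightarrow> (int \<Rightarrow> int) \<Rightarrow> nat \<Rightarrow> int \<Rightarrow> int" where
  "partial_departure a t 0 n = a n + t n"
| "partial_departure a t (Suc K) n = max (partial_departure a t K (n - 1)) (a n) + t n"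

definition departure_candidates :: "(int \<Rightarrow> int) \<Rightarrow> (int \<Rightarrow> int) \<Rightarrow> int \<Rightarrow> int set" where
  "departure_candidates a t n = (\<lambda>k. a k + (\<Sum>i=k..n. t i)) ` {..n}"

lemma sum_int_last:
  fixes t :: "int \<Rightarrow> int"
  assumes "k \<le> n"
  shows "(\<Sum>i=k..n. t i) = (\<Sum>i=k..n-1. t i) + t n"
proof -
  have "{k..n} = insert n {k..n-1}" using assms by auto
  then show ?thesis by simp
qed

text \<open>The recursion computes the maximum over k from n - K to n. This is the upper bound; that
  the value is itself one of the candidates is \<open>partial_departure_in\<close>.\<close>

lemma partial_departure_ge:
  "n - int K \<le> k \<Longrightarrow> k \<le> n \<Longrightarrow> a k + (\<Sum>i=k..n. t i) \<le> partial_departure a t K n"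
proof (induction K arbitrary: n)
  case 0
  then have "k = n" by simp
  then show ?case by simp
next
  case (Suc K)
  show ?case
  proof (cases "k = n")
    case False
    then show ?thesis using Suc.IH[of "n - 1"] Suc.prems by (simp add: sum_int_last)
  qed simp
qed

lemma partial_departure_in: "partial_departure a t K n \<in> departure_candidates a t n"
proof (induction K arbitrary: n)
  case 0
  then show ?case by (auto simp: departure_candidates_def intro!: image_eqI[of _ _ n])
next
  case (Suc K)
  from Suc[of "n - 1"] obtain k where "k \<le> n - 1"
    "partial_departure a t K (n - 1) = a k + (\<Sum>i=k..n-1. t i)"
    by (auto simp: departure_candidates_def)
  then have "partial_departure a t K (n - 1) + t n = a k + (\<Sum>i=k..n. t i)"
    by (simp add: sum_int_last)
  then show ?case
    using \<open>k \<le> n - 1\<close> unfolding departure_candidates_def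
    by (cases "a n \<le> partial_departure a t K (n - 1)")
      (auto simp: max_def intro: image_eqI[of _ _ k] image_eqI[of _ _ n])
qed

lemma partial_departure_Suc: "partial_departure a t K n \<le> partial_departure a t (Suc K) n"
proof (induction K arbitrary: n)
  case (Suc K)
  from Suc[of "n - 1"] show ?case
    by simp
qed simp

text \<open>Comparing thresholds instead of suprema needs no boundedness and turns a condition on
  all candidates into one on a monotone sequence in K.\<close>

lemma departure_candidates_ge_iff:
  "(\<exists>c\<in>departure_candidates a t n. m \<le> c) \<longleftrightarrow> (\<exists>K. m \<le> partial_departure a t K n)"
proof
  assume "\<exists>c\<in>departure_candidates a t n. m \<le> c"
  then obtain k where "k \<le> n" "m \<le> a k + (\<Sum>i=k..n. t i)"
    by (auto simp: departure_candidates_def)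
  then have "m \<le> partial_departure a t (nat (n - k)) n"
    using partial_departure_ge[of n "nat (n - k)" k a t] by auto
  then show "\<exists>K. m \<le> partial_departure a t K n" ..
qed (use partial_departure_in in blast)

lemma bdd_above_candidates_iff:
  "bdd_above (departure_candidates a t n) \<longleftrightarrow> (\<exists>m. \<forall>K. partial_departure a t K n < m)"
  (is "?L \<longleftrightarrow> ?R")
proof
  assume ?L
  then obtain b where "\<And>c. c \<in> departure_candidates a t n \<Longrightarrow> c \<le> b" by (auto simp: bdd_above_def)
  then have "\<forall>K. partial_departure a t K n < b + 1" using partial_departure_in by force
  then show ?R by blast
next
  assume ?R
  then obtain m where "\<forall>K. partial_departure a t K n < m" by blast
  then have "\<not> (\<exists>c\<in>departure_candidates a t n. m \<le> c)"
    unfolding departure_candidates_ge_iff by (auto simp: not_le)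
  then show ?L by (intro bdd_aboveI[of _ m]) force
qed

lemma le_departure_iff:
  assumes "bdd_above (departure_candidates a t n)"
  shows "m \<le> departure a t n \<longleftrightarrow> (\<exists>K. m \<le> partial_departure a t K n)"
proof -
  have dep: "departure a t n = Sup (departure_candidates a t n)"
    by (simp add: departure_def departure_candidates_def)
  have ne: "departure_candidates a t n \<noteq> {}" by (auto simp: departure_candidates_def)
  have "m \<le> departure a t n \<longleftrightarrow> (\<exists>c\<in>departure_candidates a t n. m \<le> c)"
    using less_cSup_iff[OF ne assms, of "m - 1"] by (simp add: dep diff_less_eq zle_add1_eq_le)
  then show ?thesis by (simp add: departure_candidates_ge_iff)
qed

text \<open>Lindley's recursion. Both sides are compared through the integers m below them; the
  recursion of \<open>partial_departure\<close> then passes to the supremum over K.\<close>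

lemma departure_rec:
  assumes "bdd_above (departure_candidates a t n)" "bdd_above (departure_candidates a t (n - 1))"
  shows "departure a t n = max (departure a t (n - 1)) (a n) + t n"
proof -
  have "m \<le> departure a t n \<longleftrightarrow> m \<le> max (departure a t (n - 1)) (a n) + t n" for m
  proof -
    \<comment> \<open>Monotonicity in K allows the index 0 to be dropped, so that every remaining
      term unfolds by the recursion.\<close>
    have "m \<le> departure a t n \<longleftrightarrow> (\<exists>K. m \<le> partial_departure a t (Suc K) n)"
      unfolding le_departure_iff[OF assms(1)] using partial_departure_Suc order_trans by blast
    also have "\<dots> \<longleftrightarrow> (\<exists>K. m - t n \<le> partial_departure a t K (n - 1)) \<or> m - t n \<le> a n"
      by (auto simp: le_max_iff_disj simp flip: diff_le_eq)
    also have "\<dots> \<longleftrightarrow> m - t n \<le> departure a t (n - 1) \<or> m - t n \<le> a n"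
      unfolding le_departure_iff[OF assms(2)] ..
    also have "\<dots> \<longleftrightarrow> m \<le> max (departure a t (n - 1)) (a n) + t n" by auto
    finally show ?thesis .
  qed
  from this[of "departure a t n"] this[of "max (departure a t (n - 1)) (a n) + t n"]
  show ?thesis by simp
qed

text \<open>An unbounded set of integers has no greatest element, so the description behind
  \<open>Sup\<close> describes nothing and yields one fixed integer for all such sets.\<close>

lemma Sup_int_unbounded: "\<not> bdd_above (X::int set) \<Longrightarrow> Sup X = (THE x. False)"
  unfolding Sup_int_def by (rule arg_cong[where f=The], rule ext) (auto intro: bdd_aboveI)

text \<open>Expresses the event by countable quantifiers over partial departures, including the
  default value in the unbounded case. This makes \<open>departure\<close> measurable on the whole
  space, before finiteness is known almost surely.\<close>

lemma departure_eq_iff: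
  "departure a t n = d \<longleftrightarrow>
    (if \<exists>m. \<forall>K. partial_departure a t K n < m
     then (\<exists>K. d \<le> partial_departure a t K n) \<and> (\<forall>K. partial_departure a t K n \<le> d)
     else d = (THE x. False))"
proof (cases "bdd_above (departure_candidates a t n)")
  case True
  have "departure a t n = d \<longleftrightarrow> d \<le> departure a t n \<and> \<not> d + 1 \<le> departure a t n" by auto
  also have "\<dots> \<longleftrightarrow> (\<exists>K. d \<le> partial_departure a t K n) \<and> (\<forall>K. partial_departure a t K n \<le> d)"
    unfolding le_departure_iff[OF True] by (simp add: not_le zle_add1_eq_le)
  finally show ?thesis using True by (simp add: bdd_above_candidates_iff)
next
  case False
  then have "departure a t n = (THE x. False)"
    by (simp add: departure_def Sup_int_unbounded flip: departure_candidates_def)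
  then show ?thesis using False by (auto simp: bdd_above_candidates_iff)
qed

lemma measurable_partial_departure [measurable]:
  assumes [measurable]: "\<And>n. (\<lambda>\<omega>. a \<omega> n) \<in> M \<rightarrow>\<^sub>M count_space UNIV"
    "\<And>n. (\<lambda>\<omega>. t \<omega> n) \<in> M \<rightarrow>\<^sub>M count_space UNIV"
  shows "(\<lambda>\<omega>. partial_departure (a \<omega>) (t \<omega>) K n) \<in> M \<rightarrow>\<^sub>M count_space UNIV"
proof (induction K arbitrary: n)
  case (Suc K)
  note Suc[measurable]
  show ?case by simp
qed simp

lemma measurable_departure [measurable]:
  assumes [measurable]: "\<And>n. (\<lambda>\<omega>. a \<omega> n) \<in> M \<rightarrow>\<^sub>M count_space UNIV"
    "\<And>n. (\<lambda>\<omega>. t \<omega> n) \<in> M \<rightarrow>\<^sub>M count_space UNIV"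
  shows "(\<lambda>\<omega>. departure (a \<omega>) (t \<omega>) n) \<in> M \<rightarrow>\<^sub>M count_space UNIV"
proof -
  have "{\<omega> \<in> space M. departure (a \<omega>) (t \<omega>) n = d} \<in> sets M" for d
    unfolding departure_eq_iff by measurable
  then show ?thesis
    by (subst measurable_count_space_eq_countable) (auto simp: vimage_def Int_def conj_commute)
qed

subsection \<open>Stationary sojourn times\<close>

text \<open>The second component is the idle time of the server plus the next service, that is, the
  time between departures; the third is the waiting time of the next customer plus its
  service.\<close>

definition burke :: "int \<times> int \<times> int \<Rightarrow> int \<times> int \<times> int" where
  "burke = (\<lambda>(w, a, s). (min w a, max (a - w) 0 + s, max (w - a) 0 + s))"

text \<open>This is \<open>burke\<close> conjugated by reversing the order of the triple: the time
  reversal symmetry that exchanges the queue with its dual.\<close>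

definition burke_inv :: "int \<times> int \<times> int \<Rightarrow> int \<times> int \<times> int" where
  "burke_inv = (\<lambda>(k, d, w). (max (w - d) 0 + k, max (d - w) 0 + k, min d w))"

lemma burke_inv_burke [simp]: "burke_inv (burke x) = x"
  by (auto simp: burke_def burke_inv_def split: prod.splits)

lemma burke_burke_inv [simp]: "burke (burke_inv x) = x"
  by (auto simp: burke_def burke_inv_def split: prod.splits)

definition step_pmf :: "real \<Rightarrow> real \<Rightarrow> int pmf \<Rightarrow> int pmf" where
  "step_pmf p q P = map_pmf (snd \<circ> snd \<circ> burke) (pair_pmf P (pair_pmf (geo p) (geo q)))"

text \<open>Law of a sojourn time if the system is empty when the customer K places earlier arrives;
  for K = 0 only the customer's own service remains.\<close>

fun sojourn_pmf :: "real \<Rightarrow> real \<Rightarrow> nat \<Rightarrow> int pmf" where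
  "sojourn_pmf p q 0 = geo q"
| "sojourn_pmf p q (Suc K) = step_pmf p q (sojourn_pmf p q K)"

text \<open>Condition on the gap \<alpha> and the service \<sigma>. The new sojourn time max (w -
  \<alpha>) 0 + \<sigma> reaches m for every w if m \<le> \<sigma>, and otherwise exactly when w
  \<ge> m - \<sigma> + \<alpha>.\<close>

lemma measure_step_pmf_atLeast:
  "measure (step_pmf p q P) {m..} =
    (\<integral>(\<alpha>, \<sigma>). (if m \<le> \<sigma> then 1 else measure P {m - \<sigma> + \<alpha>..}) \<partial>pair_pmf (geo p) (geo q))"
proof -
  let ?R = "pair_pmf (geo p) (geo q)"
  let ?h = "\<lambda>(\<alpha>, \<sigma>). if m \<le> \<sigma> then 1 else measure P {m - \<sigma> + \<alpha>..}"
  have "emeasure (step_pmf p q P) {m..} = (\<integral>\<^sup>+ x. indicator {m..} (snd (snd (burke x))) \<partial>pair_pmf P ?R)"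
    by (subst nn_integral_indicator[symmetric])
      (auto simp: step_pmf_def indicator_def intro!: nn_integral_cong simp del: nn_integral_indicator)
  also have "\<dots> = (\<integral>\<^sup>+ r. \<integral>\<^sup>+ w. indicator {m..} (snd (snd (burke (w, r)))) \<partial>P \<partial>?R)"
    by (subst pair_commute_pmf) (simp add: nn_integral_pair_pmf' case_prod_beta)
  also have "\<dots> = (\<integral>\<^sup>+ r. ennreal (?h r) \<partial>?R)"
  proof (rule nn_integral_cong)
    fix r :: "int \<times> int"
    obtain \<alpha> \<sigma> where r: "r = (\<alpha>, \<sigma>)" by force
    have "(\<integral>\<^sup>+ w. indicator {m..} (snd (snd (burke (w, r)))) \<partial>P) = emeasure P {w. m \<le> max (w - \<alpha>) 0 + \<sigma>}"
    proof -
      have "(\<lambda>w. indicator {m..} (snd (snd (burke (w, r)))) :: ennreal) =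
          indicator {w. m \<le> max (w - \<alpha>) 0 + \<sigma>}"
        by (auto simp: burke_def r indicator_def fun_eq_iff)
      then show ?thesis by simp
    qed
    also have "{w. m \<le> max (w - \<alpha>) 0 + \<sigma>} = (if m \<le> \<sigma> then UNIV else {m - \<sigma> + \<alpha>..})"
      by auto
    finally show "(\<integral>\<^sup>+ w. indicator {m..} (snd (snd (burke (w, r)))) \<partial>P) = ennreal (?h r)"
      by (simp add: r measure_pmf.emeasure_eq_measure split: if_splits)
  qed
  also have "\<dots> = ennreal (\<integral>r. ?h r \<partial>?R)"
    by (intro nn_integral_eq_integral measure_pmf.integrable_const_bound[where B=1]) auto
  finally show ?thesis
    by (simp add: measure_pmf.emeasure_eq_measure integral_nonneg_AE split_def)
qed

lemma measure_pmf_atLeast_tendsto_0: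
  "(\<lambda>n. measure (measure_pmf P) {int n..}) \<longlonglongrightarrow> 0"
proof -
  have "(\<lambda>n. measure (measure_pmf P) {int n..}) \<longlonglongrightarrow> measure (measure_pmf P) (\<Inter>n. {int n..})"
    by (intro measure_pmf.finite_Lim_measure_decseq) (auto simp: decseq_def)
  moreover have "(\<Inter>n. {int n..}) = {}"
  proof -
    have "x \<notin> {int (nat (x + 1))..}" for x by auto
    then show ?thesis by blast
  qed
  ultimately show ?thesis by simp
qed

section \<open>The geometric law as the limit of the sojourn laws\<close>

locale queue_parameters =
  fixes p q :: real
  assumes p0: "0 < p" and pq: "p < q" and q1: "q < 1"
begin

text \<open>The value for which the minimum of independent geometric variables with parameters
  \<rho> and p has parameter q, as (1 - \<rho>)(1 - p) = 1 - q. The mark r is such a minimum, of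
  sojourn time and gap.\<close>

definition \<rho> :: real where "\<rho> = (q - p) / (1 - p)"

lemma rho: "0 < \<rho>" "\<rho> < 1" "(1 - \<rho>) * (1 - p) = 1 - q"
  using p0 pq q1 by (auto simp: \<rho>_def field_simps)

text \<open>After the factor 1 - q is replaced by (1 - \<rho>)(1 - p), both sides carry the same
  powers of 1 - \<rho> and of 1 - p.\<close>

lemma burke_weight:
  "pmf (pair_pmf (geo q) (pair_pmf (geo p) (geo \<rho>))) (burke x) =
    pmf (pair_pmf (geo \<rho>) (pair_pmf (geo p) (geo q))) x"
proof -
  obtain w a s where x: "x = (w, a, s)" by (cases x)
  show ?thesis
  proof (cases "1 \<le> w \<and> 1 \<le> a \<and> 1 \<le> s")
    case True
    \<comment> \<open>Subtracting 1 turns the values into the exponents of the geometric weights;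
      the case split on i and j removes the minimum and the maxima.\<close>
    define i j k where "i = nat (w - 1)" "j = nat (a - 1)" "k = nat (s - 1)"
    with True have "w = int i + 1" "a = int j + 1" "s = int k + 1" by auto
    note [simp] = this
    show ?thesis
    proof (cases "i \<le> j")
      case True
      then obtain l where [simp]: "j = i + l" by (auto simp: le_iff_add)
      have "nat (int l + int k) = l + k" "nat (int i + int l) = i + l" by simp_all
      then show ?thesis using rho p0 pq q1
        by (simp add: x burke_def pmf_pair pmf_geo power_add power_mult_distrib flip: rho(3))
    next
      case False
      then obtain l where [simp]: "i = j + l" by (auto simp: not_le less_iff_Suc_add)
      have "nat (int l + int k) = l + k" "nat (int j + int l) = j + l" by simp_all
      then show ?thesis using rho p0 pq q1
        by (simp add: x burke_def pmf_pair pmf_geo power_add power_mult_distrib flip: rho(3))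
    qed
  next
    \<comment> \<open>Both weights vanish: the minimum of w and a is an output, and so is s, because
      one of the two maxima is 0. A nonpositive input thus gives a nonpositive output.\<close>
    case False
    then show ?thesis using rho p0 pq q1
      by (auto simp: x burke_def pmf_pair pmf_geo)
  qed
qed

lemma map_burke:
  "map_pmf burke (pair_pmf (geo \<rho>) (pair_pmf (geo p) (geo q))) =
    pair_pmf (geo q) (pair_pmf (geo p) (geo \<rho>))" (is "map_pmf burke ?L = ?R")
proof (rule pmf_eqI)
  fix y
  have "inj burke" by (metis burke_inv_burke injI)
  then show "pmf (map_pmf burke ?L) y = pmf ?R y"
    using pmf_map_inj'[of burke ?L "burke_inv y"] burke_weight[of "burke_inv y"] by simp
qed

text \<open>The third marginal of \<open>map_burke\<close>: the geometric law with parameter \<rho>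
  is stationary for Lindley's recursion.\<close>

lemma step_pmf_geo: "step_pmf p q (geo \<rho>) = geo \<rho>"
proof -
  have "step_pmf p q (geo \<rho>) = map_pmf snd (map_pmf snd (map_pmf burke (pair_pmf (geo \<rho>) (pair_pmf (geo p) (geo q)))))"
    by (simp add: step_pmf_def pmf.map_comp o_assoc)
  then show ?thesis by (simp add: map_burke map_snd_pair_pmf)
qed

abbreviation tail :: "nat \<Rightarrow> int \<Rightarrow> real" where
  "tail K m \<equiv> measure (sojourn_pmf p q K) {m..}"

abbreviation geo_tail :: "int \<Rightarrow> real" where
  "geo_tail m \<equiv> measure (geo \<rho>) {m..}"

text \<open>The integrand of the tail equation for an arbitrary function f in place of a tail, so
  that the equation can also be stated for limits of tails.\<close>

abbreviation step_tail :: "(int \<Rightarrow> real) \<Rightarrow> int \<Rightarrow> int \<times> int \<Rightarrow> real" where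
  "step_tail f m \<equiv> \<lambda>(\<alpha>, \<sigma>). if m \<le> \<sigma> then 1 else f (m - \<sigma> + \<alpha>)"

abbreviation R :: "(int \<times> int) pmf" where
  "R \<equiv> pair_pmf (geo p) (geo q)"

lemma tail_Suc: "tail (Suc K) m = (\<integral>r. step_tail (tail K) m r \<partial>R)"
  by (simp add: measure_step_pmf_atLeast)

lemma integrable_step_tail:
  assumes "\<And>m. 0 \<le> f m" "\<And>m. f m \<le> 1"
  shows "integrable R (step_tail f m)"
  using assms by (intro measure_pmf.integrable_const_bound[where B=1]) auto

lemma integral_step_tail_mono:
  assumes "\<And>m. 0 \<le> f m" "\<And>m. f m \<le> g m" "\<And>m. g m \<le> 1"
  shows "(\<integral>r. step_tail f m r \<partial>R) \<le> (\<integral>r. step_tail g m r \<partial>R)"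
proof -
  have "f m \<le> 1" "0 \<le> g m" for m using assms[of m] by linarith+
  then show ?thesis
    by (intro integral_mono integrable_step_tail assms) (auto intro: assms)
qed

lemma geo_tail_step: "geo_tail m = (\<integral>r. step_tail geo_tail m r \<partial>R)"
  by (subst step_pmf_geo[symmetric]) (simp add: measure_step_pmf_atLeast)

text \<open>Stochastic domination. It holds at the start because \<rho> \<le> q, and the monotone
  step operator preserves it, with \<open>geo_tail\<close> as a fixed point.\<close>

lemma tail_le_geo_tail: "tail K m \<le> geo_tail m"
proof (induction K arbitrary: m)
  case 0
  have "1 - q \<le> 1 - \<rho>"
    using p0 pq q1 by (simp add: \<rho>_def field_simps)
  then show ?case using p0 pq q1 rho
    by (simp add: measure_geo_atLeast power_mono)
next
  case (Suc K)
  show ?case unfolding tail_Suc geo_tail_step[of m]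
    by (rule integral_step_tail_mono) (use Suc in auto)
qed

text \<open>\<open>tail 0\<close> is the step operator applied to the zero function, which lies
  below \<open>tail 0\<close>; monotonicity of the operator carries the inequality to all K.\<close>

lemma tail_mono: "tail K m \<le> tail (Suc K) m"
proof (induction K arbitrary: m)
  case 0
  have "(\<integral>\<sigma>. indicator {m..} \<sigma> \<partial>geo q) = (\<integral>\<sigma>. indicator {m..} \<sigma> \<partial>map_pmf snd R)"
    by (simp only: map_snd_pair_pmf)
  also have "\<dots> = (\<integral>r. step_tail (\<lambda>_. 0) m r \<partial>R)"
    by (subst integral_map_pmf)
      (auto intro!: Bochner_Integration.integral_cong simp: indicator_def)
  finally have "(\<integral>\<sigma>. indicator {m..} \<sigma> \<partial>geo q) = (\<integral>r. step_tail (\<lambda>_. 0) m r \<partial>R)" .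
  then have "tail 0 m = (\<integral>r. step_tail (\<lambda>_. 0) m r \<partial>R)" by simp
  also have "\<dots> \<le> tail (Suc 0) m"
    unfolding tail_Suc by (rule integral_step_tail_mono) auto
  finally show ?case .
next
  case (Suc K)
  show ?case unfolding tail_Suc[of "Suc K"] by (subst tail_Suc, rule integral_step_tail_mono) (use Suc in auto)
qed

text \<open>The limit of the tails solves the same stationarity equation as the geometric tail.
  The difference is a nonnegative function vanishing at infinity that is harmonic for a
  strictly substochastic kernel, so it is zero by the maximum principle.\<close>

lemma tail_tendsto: "(\<lambda>K. tail K m) \<longlonglongrightarrow> geo_tail m"
proof -
  define G where "G m = (SUP K. tail K m)" for m
  have bdd: "bdd_above (range (\<lambda>K. tail K m))" for m
    by (rule bdd_aboveI[of _ 1]) auto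
  have lim: "(\<lambda>K. tail K m) \<longlonglongrightarrow> G m" for m
    unfolding G_def by (rule LIMSEQ_incseq_SUP[OF bdd incseq_SucI]) (rule tail_mono)
  have G_le: "G m \<le> geo_tail m" for m
    unfolding G_def by (rule cSUP_least) (auto intro: tail_le_geo_tail)
  have tail_le_G: "tail K m \<le> G m" for K m
    unfolding G_def by (rule cSUP_upper) (auto intro: bdd)
  have G0: "0 \<le> G m" for m
    using tail_le_G[of 0 m] measure_nonneg order_trans by blast
  have G1: "G m \<le> 1" for m
    using G_le[of m] measure_pmf.prob_le_1[of "geo \<rho>" "{m..}"] by linarith
  have G_step: "G m = (\<integral>r. step_tail G m r \<partial>R)" for m
  proof (rule LIMSEQ_unique)
    show "(\<lambda>K. tail (Suc K) m) \<longlonglongrightarrow> G m" by (rule LIMSEQ_Suc[OF lim])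
    show "(\<lambda>K. tail (Suc K) m) \<longlonglongrightarrow> (\<integral>r. step_tail G m r \<partial>R)"
      unfolding tail_Suc
      by (rule integral_dominated_convergence[where w="\<lambda>_. 1"]) (auto intro: lim split: prod.splits)
  qed
  define H where "H m = geo_tail m - G m" for m
  have H0: "0 \<le> H m" and H_le: "H m \<le> geo_tail m" for m
    using G_le[of m] G0[of m] by (auto simp: H_def)
  have H_low: "H m = 0" if "m \<le> 1" for m
  proof -
    have "tail 0 m = 1" using that p0 pq q1 by (simp add: measure_geo_atLeast)
    then show ?thesis using tail_le_G[of 0 m] G_le[of m] measure_pmf.prob_le_1[of "geo \<rho>" "{m..}"]
      unfolding H_def by linarith
  qed
  have "H m0 = 0" for m0
  proof (rule ccontr)
    assume "H m0 \<noteq> 0"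
    with H0[of m0] have pos: "0 < H m0" by linarith
    from order_tendstoD(2)[OF measure_pmf_atLeast_tendsto_0 pos] obtain N where
      N: "\<And>n. n \<ge> N \<Longrightarrow> geo_tail (int n) < H m0"
      by (auto simp: eventually_sequentially)
    \<comment> \<open>Outside this finite set H is 0 or smaller than H m0, so a maximum over the set
      is a global maximum.\<close>
    let ?S = "insert m0 {1..int N}"
    have "Max (H ` ?S) \<in> H ` ?S" by (rule Max_in) auto
    then obtain k where "Max (H ` ?S) = H k" "k \<in> ?S" by (rule imageE)
    then have k: "k \<in> ?S" "\<And>m. m \<in> ?S \<Longrightarrow> H m \<le> H k"
      by (auto simp flip: \<open>Max (H ` ?S) = H k\<close> intro!: Max_ge)
    have max: "H m \<le> H k" for m
    proof (cases "m \<in> ?S")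
      case False
      then consider "m \<le> 1" | "int N < m" by force
      then show ?thesis
      proof cases
        case 1
        then show ?thesis using H_low H0 by simp
      next
        case 2
        then have "geo_tail m < H m0" using N[of "nat m"] by simp
        then show ?thesis using H_le[of m] k(2)[of m0] by simp
      qed
    qed (rule k(2))
    have Hk: "0 < H k" using pos k(2)[of m0] by simp
    have int: "integrable R (step_tail geo_tail k)" "integrable R (step_tail G k)"
      by (rule integrable_step_tail; use G0 G1 in simp)+
    have "H k = (\<integral>r. step_tail geo_tail k r - step_tail G k r \<partial>R)"
      unfolding Bochner_Integration.integral_diff[OF int]
      by (simp only: H_def flip: geo_tail_step G_step)
    \<comment> \<open>For \<sigma> \<ge> k both integrands are 1 and cancel; otherwise their
      difference is a value of H, hence at most H k.\<close>
    also have "\<dots> \<le> (\<integral>r. H k * indicator {..<k} (snd r) \<partial>R)"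
    proof (rule integral_mono)
      show "integrable R (\<lambda>r. step_tail geo_tail k r - step_tail G k r)"
        by (rule Bochner_Integration.integrable_diff[OF int])
      show "integrable R (\<lambda>r. H k * indicator {..<k} (snd r))"
        by (intro measure_pmf.integrable_const_bound[where B="H k"]) (auto simp: indicator_def H0)
    qed (use max in \<open>auto simp: H_def indicator_def split: prod.splits\<close>)
    also have "\<dots> = (\<integral>\<sigma>. H k * indicator {..<k} \<sigma> \<partial>map_pmf snd R)"
      by (simp only: integral_map_pmf)
    also have "\<dots> = H k * measure (geo q) {..<k}"
      by (simp only: map_snd_pair_pmf) simp
    also have "measure (geo q) {..<k} = 1 - measure (geo q) {k..}"
      using measure_pmf.prob_compl[of "{k..}" "geo q"]
      by (simp add: Compl_eq_Diff_UNIV[symmetric] flip: Compl_atLeast)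
    \<comment> \<open>Strict because a service is at least k with positive probability, as q < 1:
      this is the mass that the kernel loses.\<close>
    also have "H k * \<dots> < H k"
      using Hk p0 pq q1 by (simp add: measure_geo_atLeast)
    finally show False by simp
  qed
  then show ?thesis using lim[of m] by (simp add: H_def)
qed

end

subsection \<open>Patterns of arrivals and services\<close>

lemma expected_count_conj_const:
  "expected_count M (\<lambda>n \<omega>. c \<and> E n \<omega>) = of_bool c * expected_count M E"
  by (cases c) (simp_all add: expected_count_def)

lemma expected_count_eq_0:
  assumes [measurable]: "\<And>n. Measurable.pred M (E n)" and "expected_count M E = 0"
  shows "AE \<omega> in M. \<forall>n. \<not> E n \<omega>"
proof -
  have "emeasure M {\<omega> \<in> space M. E n \<omega>} = 0" for n
    using assms(2) by (simp add: expected_count_def nn_integral_0_iff_AE AE_count_space)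
  then have "AE \<omega> in M. \<not> E n \<omega>" for n
    by (subst AE_iff_measurable[OF _ refl]) auto
  then show ?thesis by (simp add: AE_all_countable)
qed

lemma expected_count_mono:
  assumes [measurable]: "\<And>n. Measurable.pred M (F n)"
    and "\<And>n \<omega>. \<omega> \<in> space M \<Longrightarrow> E n \<omega> \<Longrightarrow> F n \<omega>"
  shows "expected_count M E \<le> expected_count M F"
  unfolding expected_count_def using assms(2) by (intro nn_integral_mono emeasure_mono) auto

lemma prod_list_pmf_nonneg [simp]: "0 \<le> prod_list (map (pmf P) l)"
  by (rule prod_list_nonneg) auto

text \<open>The points reached from y by the successive gaps in the list, the final point
  \<open>y + sum_list l\<close> included.\<close>

fun renewal_points :: "int \<Rightarrow> int list \<Rightarrow> int set" where
  "renewal_points y [] = {y}"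
| "renewal_points y (\<alpha> # l) = insert y (renewal_points (y + \<alpha>) l)"

lemma renewal_points_ge:
  "\<forall>\<alpha>\<in>set l. 1 \<le> \<alpha> \<Longrightarrow> x \<in> renewal_points y l \<Longrightarrow> y \<le> x"
  by (induction l arbitrary: y) force+

lemma sum_list_nonneg_int: "\<forall>\<alpha>\<in>set l. (1::int) \<le> \<alpha> \<Longrightarrow> 0 \<le> sum_list l"
  by (rule sum_list_nonneg) auto

text \<open>Removes the numbering: a statement about consecutive indices becomes one about which
  sites of a finite window are occupied, and the Bernoulli property gives the probability of the
  latter.\<close>

lemma consecutive_iff_renewal_points:
  fixes a :: "int \<Rightarrow> int"
  assumes a: "strict_mono a" and l: "\<forall>\<alpha>\<in>set l. 1 \<le> \<alpha>"
  shows "(\<exists>n. a n = y \<and> pattern (\<lambda>n. a (n + 1) - a n) n l) \<longleftrightarrow>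
    (\<forall>j\<in>{y..y + sum_list l}. j \<in> range a \<longleftrightarrow> j \<in> renewal_points y l)"
  using l
proof (induction l arbitrary: y)
  case Nil
  then show ?case by auto
next
  case (Cons \<alpha> l)
  note less = strict_mono_less[OF a]
  have \<alpha>: "1 \<le> \<alpha>" and l: "\<forall>\<alpha>\<in>set l. 1 \<le> \<alpha>" using Cons.prems by auto
  note IH = Cons.IH[OF l, of "y + \<alpha>"]
  have S: "0 \<le> sum_list l" using l by (rule sum_list_nonneg_int)
  show ?case
  proof
    assume "\<exists>n. a n = y \<and> pattern (\<lambda>n. a (n + 1) - a n) n (\<alpha> # l)"
    then obtain n where n: "a n = y" "a (n + 1) = y + \<alpha>" "pattern (\<lambda>n. a (n + 1) - a n) (n + 1) l"
      by auto
    have gap: "j \<notin> range a" if "y < j" "j < y + \<alpha>" for j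
    proof
      assume "j \<in> range a"
      then obtain m where "j = a m" by auto
      then have "a n < a m" "a m < a (n + 1)" using that n by simp_all
      then have "n < m" "m < n + 1" by (simp_all only: less)
      then show False by simp
    qed
    show "\<forall>j\<in>{y..y + sum_list (\<alpha> # l)}. j \<in> range a \<longleftrightarrow> j \<in> renewal_points y (\<alpha> # l)"
    proof
      fix j assume j: "j \<in> {y..y + sum_list (\<alpha> # l)}"
      consider "j = y" | "y < j" "j < y + \<alpha>" | "y + \<alpha> \<le> j" using j by force
      then show "j \<in> range a \<longleftrightarrow> j \<in> renewal_points y (\<alpha> # l)"
      proof cases
        case 1
        moreover have "y \<in> range a" using n(1) by blast
        ultimately show ?thesis by simp
      next
        case 2
        then show ?thesis using gap renewal_points_ge[OF l, of j "y + \<alpha>"] by auto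
      next
        case 3
        have "\<exists>n. a n = y + \<alpha> \<and> pattern (\<lambda>n. a (n + 1) - a n) n l" using n by blast
        then show ?thesis using IH 3 j \<alpha> by (simp add: add.assoc)
      qed
    qed
  next
    assume *: "\<forall>j\<in>{y..y + sum_list (\<alpha> # l)}. j \<in> range a \<longleftrightarrow> j \<in> renewal_points y (\<alpha> # l)"
    have "\<forall>j\<in>{y + \<alpha>..y + \<alpha> + sum_list l}. j \<in> range a \<longleftrightarrow> j \<in> renewal_points (y + \<alpha>) l"
      using * \<alpha> by (auto simp: add.assoc)
    then obtain m where m: "a m = y + \<alpha>" "pattern (\<lambda>n. a (n + 1) - a n) m l"
      using IH by blast
    have "y \<in> range a" using * \<alpha> S by auto
    then obtain n where n: "a n = y" by auto
    have "a n < a m" using m n \<alpha> by simp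
    then have "n < m" by (simp only: less)
    \<comment> \<open>Otherwise \<open>a (n + 1)\<close> would be an occupied site strictly between
      y and y + \<alpha>, where the window has no renewal point.\<close>
    have "m = n + 1"
    proof (rule ccontr)
      assume "m \<noteq> n + 1"
      then have "a n < a (n + 1)" "a (n + 1) < a m" using \<open>n < m\<close> by (simp_all add: less)
      then have "a (n + 1) \<in> renewal_points y (\<alpha> # l)"
        using *[rule_format, of "a (n + 1)"] m n S by auto
      then show False
        using \<open>a n < a (n + 1)\<close> \<open>a (n + 1) < a m\<close> m n renewal_points_ge[OF l, of "a (n + 1)" "y + \<alpha>"]
        by auto
    qed
    then show "\<exists>n. a n = y \<and> pattern (\<lambda>n. a (n + 1) - a n) n (\<alpha> # l)"
      using m n by (intro exI[of _ n]) auto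
  qed
qed

text \<open>A gap \<alpha> accounts for \<alpha> - 1 empty sites and one occupied site, which is its
  geometric weight. The extra factor c belongs to one occupied site beyond those charged to the
  gaps.\<close>

lemma prod_renewal_points:
  assumes "0 < c" "c \<le> 1" and l: "\<forall>\<alpha>\<in>set l. 1 \<le> \<alpha>"
  shows "(\<Prod>j\<in>{y..y + sum_list l}. if j \<in> renewal_points y l then c else 1 - c) =
    c * (\<Prod>\<alpha>\<leftarrow>l. pmf (geo c) \<alpha>)"
  using l
proof (induction l arbitrary: y)
  case (Cons \<alpha> l)
  have \<alpha>: "1 \<le> \<alpha>" and l: "\<forall>\<alpha>\<in>set l. 1 \<le> \<alpha>" using Cons.prems by auto
  let ?f = "\<lambda>j. if j \<in> renewal_points y (\<alpha> # l) then c else 1 - c"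
  let ?I = "{y + \<alpha>..y + \<alpha> + sum_list l}"
  have "{y..y + sum_list (\<alpha> # l)} = insert y ({y<..<y + \<alpha>} \<union> ?I)"
    using \<alpha> sum_list_nonneg_int[OF l] by auto
  then have "(\<Prod>j\<in>{y..y + sum_list (\<alpha> # l)}. ?f j) = c * prod ?f ({y<..<y + \<alpha>} \<union> ?I)"
    using \<alpha> by simp
  also have "\<dots> = c * (prod ?f {y<..<y + \<alpha>} * prod ?f ?I)"
    by (subst prod.union_disjoint) auto
  also have "prod ?f {y<..<y + \<alpha>} = (\<Prod>j\<in>{y<..<y + \<alpha>}. 1 - c)"
    using renewal_points_ge[OF l] by (intro prod.cong) force+
  also have "\<dots> = (1 - c) ^ nat (\<alpha> - 1)" by simp
  also have "prod ?f ?I = (\<Prod>j\<in>?I. if j \<in> renewal_points (y + \<alpha>) l then c else 1 - c)"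
    using \<alpha> by (intro prod.cong) auto
  also have "\<dots> = c * (\<Prod>\<alpha>\<leftarrow>l. pmf (geo c) \<alpha>)"
    by (rule Cons.IH[OF l])
  finally show ?case using \<alpha> assms by (simp add: pmf_geo)
qed simp

lemma (in prob_space) indep_events_prob_iff:
  assumes ind: "indep_events (\<lambda>j. {\<omega> \<in> space M. j \<in> X \<omega>}) UNIV"
    and p: "\<And>j. prob {\<omega> \<in> space M. j \<in> X \<omega>} = c"
    and J: "finite J" "J \<noteq> {}"
  shows "prob {\<omega> \<in> space M. \<forall>j\<in>J. j \<in> X \<omega> \<longleftrightarrow> j \<in> B} = (\<Prod>j\<in>J. if j \<in> B then c else 1 - c)"
proof -
  let ?E = "\<lambda>j. {\<omega> \<in> space M. j \<in> X \<omega>}"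
  have E: "?E j \<in> events" for j using ind by (auto simp: indep_events_def)
  define F where "F j = (if j \<in> B then ?E j else space M - ?E j)" for j
  \<comment> \<open>Independence is passed to the generated sigma-algebras because the event also
    involves complements, for the empty sites.\<close>
  have "indep_sets (\<lambda>j. sigma_sets (space M) {?E j}) UNIV"
    using ind by (intro indep_sets_sigma) (auto simp: indep_events_def_alt Int_stable_def)
  then have "prob (\<Inter>j\<in>J. F j) = (\<Prod>j\<in>J. prob (F j))"
    by (rule indep_setsD) (use J in \<open>auto simp: F_def intro!: sigma_sets.Compl\<close>)
  also have "(\<Inter>j\<in>J. F j) = {\<omega> \<in> space M. \<forall>j\<in>J. j \<in> X \<omega> \<longleftrightarrow> j \<in> B}"
  proof -
    have "F j = {\<omega> \<in> space M. j \<in> X \<omega> \<longleftrightarrow> j \<in> B}" for j by (auto simp: F_def)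
    then show ?thesis using J by auto
  qed
  also have "(\<Prod>j\<in>J. prob (F j)) = (\<Prod>j\<in>J. if j \<in> B then c else 1 - c)"
    using E p by (intro prod.cong) (auto simp: F_def prob_compl)
  finally show ?thesis .
qed

section \<open>The queue and the laws of its input patterns\<close>

locale queue = prob_space M + queue_parameters p q for M :: "'a measure" and p q +
  fixes A s :: "int \<Rightarrow> 'a \<Rightarrow> int"
  assumes bernoulli: "bernoulli_point_process M p (\<lambda>\<omega>. range (\<lambda>n. A n \<omega>))"
    and mono_A: "AE \<omega> in M. strict_mono (\<lambda>n. A n \<omega>)"
    and indep_s: "indep_vars (\<lambda>_. count_space UNIV) s UNIV"
    and law_s: "\<And>n k. 1 \<le> k \<Longrightarrow> prob {\<omega> \<in> space M. s n \<omega> = int k} = (1 - q) ^ (k - 1) * q"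
    and indep_A_s: "indep_var
      (\<Pi>\<^sub>M n\<in>UNIV. count_space UNIV) (\<lambda>\<omega> n. A n \<omega>)
      (\<Pi>\<^sub>M n\<in>UNIV. count_space UNIV) (\<lambda>\<omega> n. s n \<omega>)"
begin

lemma measurable_A [measurable]: "A n \<in> M \<rightarrow>\<^sub>M count_space UNIV"
  using measurable_compose[OF indep_var_rv1[OF indep_A_s] measurable_component_singleton[of n UNIV]]
  by simp

lemma measurable_s [measurable]: "s n \<in> M \<rightarrow>\<^sub>M count_space UNIV"
  using measurable_compose[OF indep_var_rv2[OF indep_A_s] measurable_component_singleton[of n UNIV]]
  by simp

text \<open>The prescribed probabilities of the positive values already sum to 1.\<close>

lemma AE_s_ge_1: "AE \<omega> in M. \<forall>n. 1 \<le> s n \<omega>"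
proof -
  have "AE \<omega> in M. 1 \<le> s n \<omega>" for n
  proof -
    have "emeasure M {\<omega> \<in> space M. 1 \<le> s n \<omega>} =
        (\<integral>\<^sup>+ k. emeasure M {\<omega> \<in> space M. 1 \<le> s n \<omega> \<and> s n \<omega> = k} \<partial>count_space UNIV)"
      by (rule emeasure_partition) auto
    also have "\<dots> = (\<integral>\<^sup>+ k. ennreal (pmf (geo q) k) \<partial>count_space UNIV)"
    proof (rule nn_integral_cong)
      fix k :: int
      show "emeasure M {\<omega> \<in> space M. 1 \<le> s n \<omega> \<and> s n \<omega> = k} = ennreal (pmf (geo q) k)"
      proof (cases "1 \<le> k")
        case True
        then have "{\<omega> \<in> space M. 1 \<le> s n \<omega> \<and> s n \<omega> = k} = {\<omega> \<in> space M. s n \<omega> = int (nat k)}"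
          by auto
        moreover have "nat (k - 1) = nat k - 1" using True by simp
        ultimately show ?thesis using law_s[of "nat k" n] True p0 pq q1
          by (simp add: emeasure_eq_measure pmf_geo)
      next
        case False
        then have "{\<omega> \<in> space M. 1 \<le> s n \<omega> \<and> s n \<omega> = k} = {}" by auto
        then show ?thesis using False p0 pq q1 by (simp add: pmf_geo del: Collect_empty_eq)
      qed
    qed
    also have "\<dots> = 1" by (simp add: nn_integral_pmf)
    finally show ?thesis
      by (subst prob_Collect_eq_1[symmetric]) (auto simp: emeasure_eq_measure)
  qed
  then show ?thesis by (simp add: AE_all_countable)
qed

lemma prob_s: "prob {\<omega> \<in> space M. s n \<omega> = k} = pmf (geo q) k"
proof (cases "1 \<le> k")
  case True
  moreover have "nat (k - 1) = nat k - 1" using True by simp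
  ultimately show ?thesis using law_s[of "nat k" n] p0 pq q1 by (simp add: pmf_geo)
next
  case False
  have "prob {\<omega> \<in> space M. s n \<omega> = k} = 0"
    by (subst prob_Collect_eq_0) (use AE_s_ge_1 False in \<open>auto elim: eventually_mono\<close>)
  then show ?thesis using False p0 pq q1 by (simp add: pmf_geo)
qed

lemma prob_pattern_s:
  "prob {\<omega> \<in> space M. pattern (\<lambda>n. s n \<omega>) n ks} = (\<Prod>k\<leftarrow>ks. pmf (geo q) k)"
proof (cases "ks = []")
  case False
  define J where "J = (\<lambda>i. n + int i) ` {..<length ks}"
  have inj: "inj_on (\<lambda>i. n + int i) {..<length ks}" by (auto simp: inj_on_def)
  have "{\<omega> \<in> space M. pattern (\<lambda>n. s n \<omega>) n ks} =
      (\<Inter>j\<in>J. s j -` {ks ! nat (j - n)} \<inter> space M)"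
    using False by (auto simp: J_def pattern_def)
  also have "prob \<dots> = (\<Prod>j\<in>J. prob (s j -` {ks ! nat (j - n)} \<inter> space M))"
    by (rule indep_varsD[OF indep_s]) (use False in \<open>auto simp: J_def\<close>)
  also have "\<dots> = (\<Prod>j\<in>J. pmf (geo q) (ks ! nat (j - n)))"
    by (intro prod.cong refl) (simp add: prob_s vimage_def Int_def conj_commute)
  also have "\<dots> = (\<Prod>i<length ks. pmf (geo q) (ks ! i))"
    unfolding J_def by (subst prod.reindex[OF inj]) simp
  also have "\<dots> = (\<Prod>k\<leftarrow>ks. pmf (geo q) k)"
    by (simp add: prod.list_conv_set_nth atLeast0LessThan)
  finally show ?thesis .
qed (simp add: prob_space)

abbreviation gap :: "int \<Rightarrow> 'a \<Rightarrow> int" where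
  "gap n \<omega> \<equiv> A (n + 1) \<omega> - A n \<omega>"

text \<open>At most one point sits at y, so the count is the probability of one occupation pattern
  of a finite window. The result does not depend on y, which expresses stationarity in
  space.\<close>

lemma expected_count_gaps:
  "expected_count M (\<lambda>n \<omega>. A n \<omega> = y \<and> pattern (\<lambda>n. gap n \<omega>) n l) =
    ennreal (p * (\<Prod>\<alpha>\<leftarrow>l. pmf (geo p) \<alpha>))"
proof (cases "\<forall>\<alpha>\<in>set l. 1 \<le> \<alpha>")
  case True
  let ?J = "{y..y + sum_list l}"
  have [measurable]: "Measurable.pred M (\<lambda>\<omega>. j \<in> range (\<lambda>n. A n \<omega>))" for j
    unfolding image_def by simp
  have "expected_count M (\<lambda>n \<omega>. A n \<omega> = y \<and> pattern (\<lambda>n. gap n \<omega>) n l) =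
      emeasure M {\<omega> \<in> space M. \<exists>n. A n \<omega> = y \<and> pattern (\<lambda>n. gap n \<omega>) n l}"
  proof (rule expected_count_unique)
    show "AE \<omega> in M. \<forall>n m. A n \<omega> = y \<and> pattern (\<lambda>n. gap n \<omega>) n l \<longrightarrow>
        A m \<omega> = y \<and> pattern (\<lambda>n. gap n \<omega>) m l \<longrightarrow> n = m"
      using mono_A by eventually_elim (metis strict_mono_eq)
  qed measurable
  also have "\<dots> = emeasure M {\<omega> \<in> space M. \<forall>j\<in>?J. j \<in> range (\<lambda>n. A n \<omega>) \<longleftrightarrow> j \<in> renewal_points y l}"
  proof (rule emeasure_eq_AE)
    show "AE \<omega> in M. (\<omega> \<in> {\<omega> \<in> space M. \<exists>n. A n \<omega> = y \<and> pattern (\<lambda>n. gap n \<omega>) n l}) =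
      (\<omega> \<in> {\<omega> \<in> space M. \<forall>j\<in>?J. j \<in> range (\<lambda>n. A n \<omega>) \<longleftrightarrow> j \<in> renewal_points y l})"
      using mono_A
    proof eventually_elim
      case (elim \<omega>)
      from consecutive_iff_renewal_points[OF this True, of y] show ?case by simp
    qed
  qed measurable
  also have "\<dots> = ennreal (\<Prod>j\<in>?J. if j \<in> renewal_points y l then p else 1 - p)"
    using bernoulli sum_list_nonneg_int[OF True] unfolding emeasure_eq_measure
    by (subst indep_events_prob_iff) (auto simp: bernoulli_point_process_def)
  also have "\<dots> = ennreal (p * (\<Prod>\<alpha>\<leftarrow>l. pmf (geo p) \<alpha>))"
    using p0 pq q1 by (subst prod_renewal_points[OF _ _ True]) auto
  finally show ?thesis .
next
  \<comment> \<open>A gap below 1 is impossible for increasing points and has geometric weight 0, so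
    both sides vanish.\<close>
  case False
  then obtain i where i: "i < length l" "l ! i < 1" by (auto simp: set_conv_nth)
  have "expected_count M (\<lambda>n \<omega>. A n \<omega> = y \<and> pattern (\<lambda>n. gap n \<omega>) n l) = expected_count M (\<lambda>_ _. False)"
  proof (rule expected_count_cong_AE)
    show "AE \<omega> in M. \<forall>n. (A n \<omega> = y \<and> pattern (\<lambda>n. gap n \<omega>) n l) = False"
      using mono_A
    proof eventually_elim
      case (elim \<omega>)
      then have "1 \<le> gap n \<omega>" for n using strict_monoD[OF elim, of n "n + 1"] by simp
      then have "\<not> pattern (\<lambda>n. gap n \<omega>) n l" for n
        using i unfolding pattern_def by (metis not_le)
      then show ?case by simp
    qed
  qed measurable
  then have "expected_count M (\<lambda>n \<omega>. A n \<omega> = y \<and> pattern (\<lambda>n. gap n \<omega>) n l) = 0"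
    by (simp add: expected_count_def)
  moreover have "pmf (geo p) (l ! i) = 0" using i p0 pq q1 by (simp add: pmf_geo)
  then have "(\<Prod>\<alpha>\<leftarrow>l. pmf (geo p) \<alpha>) = 0"
    using i by (force simp: prod_list_zero_iff)
  ultimately show ?thesis by simp
qed

text \<open>For each fixed n the two patterns are independent, and the probability of the service
  pattern does not depend on n, so it factors out of the sum over n.\<close>

lemma expected_count_gaps_services:
  "expected_count M (\<lambda>n \<omega>. A n \<omega> = y \<and> pattern (\<lambda>n. gap n \<omega>) n l \<and> pattern (\<lambda>n. s n \<omega>) n ks) =
    ennreal (p * (\<Prod>\<alpha>\<leftarrow>l. pmf (geo p) \<alpha>) * (\<Prod>k\<leftarrow>ks. pmf (geo q) k))"
proof -
  let ?S = "PiM (UNIV :: int set) (\<lambda>_. count_space (UNIV :: int set))"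
  have "emeasure M {\<omega> \<in> space M. A n \<omega> = y \<and> pattern (\<lambda>n. gap n \<omega>) n l \<and> pattern (\<lambda>n. s n \<omega>) n ks} =
     emeasure M {\<omega> \<in> space M. A n \<omega> = y \<and> pattern (\<lambda>n. gap n \<omega>) n l} * ennreal (\<Prod>k\<leftarrow>ks. pmf (geo q) k)" for n
  proof -
    let ?X = "{f \<in> space ?S. f n = y \<and> pattern (\<lambda>n. f (n + 1) - f n) n l}"
    let ?Y = "{f \<in> space ?S. pattern f n ks}"
    have XY: "?X \<in> sets ?S" "?Y \<in> sets ?S" by measurable
    have [simp]: "space ?S = UNIV" by (auto simp: space_PiM)
    from indep_varD[OF indep_A_s XY] show ?thesis
      by (simp add: emeasure_eq_measure vimage_def Int_def conj_commute conj_left_commute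
        prob_pattern_s ennreal_mult'')
  qed
  then have "expected_count M (\<lambda>n \<omega>. A n \<omega> = y \<and> pattern (\<lambda>n. gap n \<omega>) n l \<and> pattern (\<lambda>n. s n \<omega>) n ks) =
    expected_count M (\<lambda>n \<omega>. A n \<omega> = y \<and> pattern (\<lambda>n. gap n \<omega>) n l) * ennreal (\<Prod>k\<leftarrow>ks. pmf (geo q) k)"
    unfolding expected_count_def by (simp add: nn_integral_multc)
  also have "\<dots> = ennreal (p * (\<Prod>\<alpha>\<leftarrow>l. pmf (geo p) \<alpha>) * (\<Prod>k\<leftarrow>ks. pmf (geo q) k))"
    using p0 by (simp add: expected_count_gaps ennreal_mult'')
  finally show ?thesis .
qed

end

lemma measurable_ge_count_space:
  fixes f :: "'a \<Rightarrow> int"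
  assumes "f \<in> M \<rightarrow>\<^sub>M count_space UNIV"
  shows "Measurable.pred M (\<lambda>\<omega>. m \<le> f \<omega>)"
  using measurable_compose[OF assms measurable_count_space, of "\<lambda>x. m \<le> x"] by simp

text \<open>Extends a count known at single values of f to sets of values: half-lines give tails,
  and \<open>S = UNIV\<close> sums the variable out.\<close>

lemma expected_count_Collect:
  fixes f :: "int \<Rightarrow> 'a \<Rightarrow> int"
  assumes [measurable]: "\<And>n. Measurable.pred M (E n)" "\<And>n. f n \<in> M \<rightarrow>\<^sub>M count_space UNIV"
    and law: "\<And>w. expected_count M (\<lambda>n \<omega>. f n \<omega> = w \<and> E n \<omega>) = ennreal (c * pmf P w)"
    and c: "0 \<le> c"
  shows "expected_count M (\<lambda>n \<omega>. f n \<omega> \<in> S \<and> E n \<omega>) = ennreal (c * measure P S)"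
proof -
  have "expected_count M (\<lambda>n \<omega>. f n \<omega> \<in> S \<and> E n \<omega>) =
    (\<integral>\<^sup>+ w. expected_count M (\<lambda>n \<omega>. (f n \<omega> \<in> S \<and> E n \<omega>) \<and> f n \<omega> = w) \<partial>count_space UNIV)"
    by (rule expected_count_partition) measurable
  also have "\<dots> = (\<integral>\<^sup>+ w. expected_count M (\<lambda>n \<omega>. w \<in> S \<and> f n \<omega> = w \<and> E n \<omega>) \<partial>count_space UNIV)"
    by (intro nn_integral_cong expected_count_cong) auto
  also have "\<dots> = (\<integral>\<^sup>+ w. ennreal c * (ennreal (pmf P w) * indicator S w) \<partial>count_space UNIV)"
    using c by (intro nn_integral_cong)
      (simp add: expected_count_conj_const law ennreal_mult' indicator_def)
  also have "\<dots> = ennreal c * (\<integral>\<^sup>+ w. indicator S w \<partial>P)"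
    by (simp add: nn_integral_cmult nn_integral_measure_pmf del: nn_integral_indicator)
  also have "\<dots> = ennreal (c * measure P S)"
    using c by (simp add: measure_pmf.emeasure_eq_measure ennreal_mult')
  finally show ?thesis .
qed

section \<open>Sojourn times of the queue\<close>

context queue
begin

abbreviation partial_sojourn :: "nat \<Rightarrow> int \<Rightarrow> 'a \<Rightarrow> int" where
  "partial_sojourn K n \<omega> \<equiv> partial_departure (\<lambda>k. A k \<omega>) (\<lambda>k. s k \<omega>) K n - A n \<omega>"

text \<open>The fresh input that leads from customer n to n + 1. The service has index n + 1, since
  that of customer n is already part of its sojourn time.\<close>

abbreviation incoming :: "int \<Rightarrow> 'a \<Rightarrow> int \<times> int" where
  "incoming n \<omega> \<equiv> (gap n \<omega>, s (n + 1) \<omega>)"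

lemma measurable_le_partial_sojourn [measurable]:
  "Measurable.pred M (\<lambda>\<omega>. m \<le> partial_sojourn K n \<omega>)"
  by (rule measurable_ge_count_space) measurable

lemma pattern_incoming_0:
  "partial_sojourn 0 n \<omega> = w \<and> pattern (\<lambda>n. incoming n \<omega>) n l \<longleftrightarrow>
    pattern (\<lambda>n. gap n \<omega>) n (map fst l) \<and> pattern (\<lambda>n. s n \<omega>) n (w # map snd l)"
proof -
  have "pattern (\<lambda>n. s (n + 1) \<omega>) n ks = pattern (\<lambda>n. s n \<omega>) (n + 1) ks" for ks
    by (simp add: pattern_def algebra_simps)
  then show ?thesis by (auto simp: pattern_Pair)
qed

lemma partial_sojourn_Suc:
  "partial_sojourn (Suc K) (n + 1) \<omega> = snd (snd (burke (partial_sojourn K n \<omega>, incoming n \<omega>)))"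
  by (simp add: burke_def)

text \<open>In the sense of counts, the truncated sojourn time is independent of the position of the
  arrival and of all later inputs. Induction on K follows Lindley's recursion; y and l vary because
  one step moves the position and lengthens the pattern.\<close>

lemma expected_count_partial_sojourn:
  "expected_count M (\<lambda>n \<omega>. partial_sojourn K n \<omega> = w \<and> A n \<omega> = y \<and> pattern (\<lambda>n. incoming n \<omega>) n l) =
    ennreal (p * (\<Prod>x\<leftarrow>l. pmf R x) * pmf (sojourn_pmf p q K) w)"
proof (induction K arbitrary: w y l)
  case 0
  have "expected_count M (\<lambda>n \<omega>. partial_sojourn 0 n \<omega> = w \<and> A n \<omega> = y \<and> pattern (\<lambda>n. incoming n \<omega>) n l) =
    expected_count M (\<lambda>n \<omega>. A n \<omega> = y \<and> pattern (\<lambda>n. gap n \<omega>) n (map fst l) \<and>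
      pattern (\<lambda>n. s n \<omega>) n (w # map snd l))"
    by (intro expected_count_cong) (use pattern_incoming_0 in blast)
  also have "\<dots> = ennreal (p * (\<Prod>\<alpha>\<leftarrow>map fst l. pmf (geo p) \<alpha>) * (\<Prod>k\<leftarrow>w # map snd l. pmf (geo q) k))"
    by (rule expected_count_gaps_services)
  also have "(\<Prod>\<alpha>\<leftarrow>map fst l. pmf (geo p) \<alpha>) * (\<Prod>k\<leftarrow>map snd l. pmf (geo q) k) = (\<Prod>x\<leftarrow>l. pmf R x)"
    by (induction l) (auto simp: pmf_pair)
  then have "p * (\<Prod>\<alpha>\<leftarrow>map fst l. pmf (geo p) \<alpha>) * (\<Prod>k\<leftarrow>w # map snd l. pmf (geo q) k) =
      p * (\<Prod>x\<leftarrow>l. pmf R x) * pmf (sojourn_pmf p q 0) w"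
    by (simp add: ac_simps)
  finally show ?case .
next
  case (Suc K)
  let ?E = "\<lambda>n \<omega>. partial_sojourn (Suc K) n \<omega> = w \<and> A n \<omega> = y \<and> pattern (\<lambda>n. incoming n \<omega>) n l"
  let ?f = "\<lambda>n \<omega>. (partial_sojourn K n \<omega>, incoming n \<omega>)"
  let ?P = "pair_pmf (sojourn_pmf p q K) R"
  let ?c = "p * (\<Prod>x\<leftarrow>l. pmf R x)"
  have c: "0 \<le> ?c" using p0 by simp
  have "expected_count M ?E = expected_count M (\<lambda>n. ?E (n + 1))"
    by (rule expected_count_shift[symmetric])
  also have "\<dots> = (\<integral>\<^sup>+ x. expected_count M (\<lambda>n \<omega>. ?E (n + 1) \<omega> \<and> ?f n \<omega> = x) \<partial>count_space UNIV)"
    by (rule expected_count_partition) measurable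
  also have "\<dots> = (\<integral>\<^sup>+ x. ennreal ?c * (ennreal (pmf ?P x) * indicator ((snd \<circ> snd \<circ> burke) -` {w}) x) \<partial>count_space UNIV)"
  proof (rule nn_integral_cong)
    fix x :: "int \<times> int \<times> int"
    obtain w' \<alpha> \<sigma> where x: "x = (w', \<alpha>, \<sigma>)" by (cases x)
    \<comment> \<open>Given the previous triple x, the previous arrival is at y - \<alpha>, and
      (\<alpha>, \<sigma>) becomes the first entry of the pattern of later inputs.\<close>
    have "expected_count M (\<lambda>n \<omega>. ?E (n + 1) \<omega> \<and> ?f n \<omega> = x) =
      expected_count M (\<lambda>n \<omega>. snd (snd (burke x)) = w \<and> partial_sojourn K n \<omega> = w' \<and>
        A n \<omega> = y - \<alpha> \<and> pattern (\<lambda>n. incoming n \<omega>) n ((\<alpha>, \<sigma>) # l))"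
      by (rule expected_count_cong) (auto simp: x partial_sojourn_Suc simp del: partial_departure.simps)
    also have "\<dots> = of_bool (snd (snd (burke x)) = w) * ennreal (?c * pmf ?P x)"
      by (subst expected_count_conj_const, subst Suc.IH) (simp add: x pmf_pair ac_simps)
    also have "\<dots> = ennreal ?c * (ennreal (pmf ?P x) * indicator ((snd \<circ> snd \<circ> burke) -` {w}) x)"
      using c by (simp add: ennreal_mult' indicator_def)
    finally show "expected_count M (\<lambda>n \<omega>. ?E (n + 1) \<omega> \<and> ?f n \<omega> = x) = \<dots>" .
  qed
  also have "\<dots> = ennreal ?c * (\<integral>\<^sup>+ x. indicator ((snd \<circ> snd \<circ> burke) -` {w}) x \<partial>?P)"
    by (simp add: nn_integral_cmult nn_integral_measure_pmf del: nn_integral_indicator)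
  also have "\<dots> = ennreal (?c * pmf (sojourn_pmf p q (Suc K)) w)"
    using c by (simp add: step_pmf_def pmf_map measure_pmf.emeasure_eq_measure ennreal_mult')
  finally show ?case .
qed

lemma expected_count_partial_sojourn_exceeds:
  "expected_count M (\<lambda>n \<omega>. (\<exists>K. m \<le> partial_sojourn K n \<omega>) \<and> A n \<omega> = y \<and> pattern (\<lambda>n. incoming n \<omega>) n l) =
    ennreal (p * (\<Prod>x\<leftarrow>l. pmf R x) * geo_tail m)"
proof -
  let ?E = "\<lambda>K n \<omega>. m \<le> partial_sojourn K n \<omega> \<and> A n \<omega> = y \<and> pattern (\<lambda>n. incoming n \<omega>) n l"
  let ?c = "p * (\<Prod>x\<leftarrow>l. pmf R x)"
  have "expected_count M (\<lambda>n \<omega>. \<exists>K. ?E K n \<omega>) = (SUP K. expected_count M (?E K))"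
  proof (rule expected_count_incseq)
    show "?E (Suc K) n \<omega>" if "?E K n \<omega>" for K n \<omega>
      using that partial_departure_Suc[of "\<lambda>k. A k \<omega>" "\<lambda>k. s k \<omega>" K n]
      by (simp del: partial_departure.simps)
  qed measurable
  moreover have *: "expected_count M (?E K) = ennreal (?c * tail K m)" for K
    using expected_count_Collect[where S="{m..}" and f="partial_sojourn K" and P="sojourn_pmf p q K" and c="?c" and M=M
      and E="\<lambda>n \<omega>. A n \<omega> = y \<and> pattern (\<lambda>n. incoming n \<omega>) n l"] expected_count_partial_sojourn p0
    by simp
  moreover have "(SUP K. ennreal (?c * tail K m)) = ennreal (?c * geo_tail m)"
  proof (rule LIMSEQ_unique[OF LIMSEQ_SUP])
    show "incseq (\<lambda>K. ennreal (?c * tail K m))"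
      using p0 by (intro incseq_SucI ennreal_leI mult_left_mono tail_mono) simp
    show "(\<lambda>K. ennreal (?c * tail K m)) \<longlonglongrightarrow> ennreal (?c * geo_tail m)"
      by (intro tendsto_ennrealI tendsto_mult tendsto_const tail_tendsto)
  qed
  ultimately show ?thesis by simp
qed

text \<open>The count of customers at y whose truncated sojourn times are unbounded in K is at most
  \<open>p * geo_tail m\<close> for every m, hence 0.\<close>

lemma AE_bdd_above: "AE \<omega> in M. \<forall>n. bdd_above (departure_candidates (\<lambda>k. A k \<omega>) (\<lambda>k. s k \<omega>) n)"
proof -
  \<comment> \<open>Fixing the position y keeps the bounding counts finite; summed over all
    positions they would be infinite.\<close>
  let ?E = "\<lambda>y n \<omega>. (\<forall>m. \<exists>K. m \<le> partial_sojourn K n \<omega>) \<and> A n \<omega> = y"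
  have "AE \<omega> in M. \<forall>n. \<not> ?E y n \<omega>" for y
  proof (rule expected_count_eq_0)
    have "expected_count M (?E y) \<le> ennreal (p * geo_tail (int m))" for m
    proof -
      have "expected_count M (?E y) \<le>
          expected_count M (\<lambda>n \<omega>. (\<exists>K. int m \<le> partial_sojourn K n \<omega>) \<and> A n \<omega> = y \<and> pattern (\<lambda>n. incoming n \<omega>) n [])"
        by (rule expected_count_mono) (measurable, auto)
      then show ?thesis unfolding expected_count_partial_sojourn_exceeds by simp
    qed
    moreover have "(\<lambda>m. ennreal (p * geo_tail (int m))) \<longlonglongrightarrow> ennreal (p * 0)"
      by (intro tendsto_ennrealI tendsto_mult tendsto_const measure_pmf_atLeast_tendsto_0)
    ultimately have "expected_count M (?E y) \<le> ennreal (p * 0)"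
      by (intro LIMSEQ_le_const) auto
    then show "expected_count M (?E y) = 0" by simp
  qed measurable
  then have "AE \<omega> in M. \<forall>y n. \<not> ?E y n \<omega>" by (simp add: AE_all_countable)
  then show ?thesis
  proof eventually_elim
    case (elim \<omega>)
    show ?case
    proof
      fix n
      from elim[rule_format, of n "A n \<omega>"] obtain m where "\<forall>K. partial_sojourn K n \<omega> < m"
        by (auto simp: not_le)
      then have "\<forall>K. partial_departure (\<lambda>k. A k \<omega>) (\<lambda>k. s k \<omega>) K n < m + A n \<omega>"
        by (simp add: diff_less_eq)
      then show "bdd_above (departure_candidates (\<lambda>k. A k \<omega>) (\<lambda>k. s k \<omega>) n)"
        unfolding bdd_above_candidates_iff by blast
    qed
  qed
qed

abbreviation D :: "int \<Rightarrow> 'a \<Rightarrow> int" where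
  "D n \<omega> \<equiv> departure (\<lambda>k. A k \<omega>) (\<lambda>k. s k \<omega>) n"

abbreviation r :: "int \<Rightarrow> 'a \<Rightarrow> int" where
  "r n \<omega> \<equiv> dual_departure (\<lambda>k. A k \<omega>) (\<lambda>k. s k \<omega>) n"

abbreviation sojourn :: "int \<Rightarrow> 'a \<Rightarrow> int" where
  "sojourn n \<omega> \<equiv> D n \<omega> - A n \<omega>"

lemma measurable_r [measurable]: "r n \<in> M \<rightarrow>\<^sub>M count_space UNIV"
  unfolding dual_departure_def by measurable

lemma measurable_le_sojourn [measurable]: "Measurable.pred M (\<lambda>\<omega>. m \<le> sojourn n \<omega>)"
  by (rule measurable_ge_count_space) measurable

text \<open>Almost surely the truncated sojourn times reach exactly the thresholds that the true one
  reaches, which gives the tails. Subtracting the tails at w and w + 1 leaves the point mass; the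
  terms are finite, so they cancel in \<open>ennreal\<close>.\<close>

lemma expected_count_sojourn:
  "expected_count M (\<lambda>n \<omega>. sojourn n \<omega> = w \<and> A n \<omega> = y \<and> pattern (\<lambda>n. incoming n \<omega>) n l) =
    ennreal (p * (\<Prod>x\<leftarrow>l. pmf R x) * pmf (geo \<rho>) w)"
proof -
  let ?F = "\<lambda>n \<omega>. A n \<omega> = y \<and> pattern (\<lambda>n. incoming n \<omega>) n l"
  let ?c = "p * (\<Prod>x\<leftarrow>l. pmf R x)"
  have c: "0 \<le> ?c" using p0 by simp
  have ge: "expected_count M (\<lambda>n \<omega>. m \<le> sojourn n \<omega> \<and> ?F n \<omega>) = ennreal (?c * geo_tail m)" for m
  proof -
    have "expected_count M (\<lambda>n \<omega>. m \<le> sojourn n \<omega> \<and> ?F n \<omega>) =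
        expected_count M (\<lambda>n \<omega>. (\<exists>K. m \<le> partial_sojourn K n \<omega>) \<and> ?F n \<omega>)"
    proof (rule expected_count_cong_AE)
      show "AE \<omega> in M. \<forall>n. (m \<le> sojourn n \<omega> \<and> ?F n \<omega>) = ((\<exists>K. m \<le> partial_sojourn K n \<omega>) \<and> ?F n \<omega>)"
        using AE_bdd_above by eventually_elim (simp add: le_diff_eq le_departure_iff)
    qed measurable
    then show ?thesis unfolding expected_count_partial_sojourn_exceeds .
  qed
  have "expected_count M (\<lambda>n \<omega>. w \<le> sojourn n \<omega> \<and> ?F n \<omega>) =
    expected_count M (\<lambda>n \<omega>. sojourn n \<omega> = w \<and> ?F n \<omega>) +
    expected_count M (\<lambda>n \<omega>. w + 1 \<le> sojourn n \<omega> \<and> ?F n \<omega>)"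
    unfolding expected_count_def
    by (subst nn_integral_add[symmetric], simp, simp, intro nn_integral_cong,
      subst plus_emeasure) (auto intro!: arg_cong[where f="emeasure M"])
  then have "ennreal (?c * geo_tail w) =
    expected_count M (\<lambda>n \<omega>. sojourn n \<omega> = w \<and> ?F n \<omega>) + ennreal (?c * geo_tail (w + 1))"
    by (simp only: ge)
  moreover have "geo_tail w = pmf (geo \<rho>) w + geo_tail (w + 1)"
  proof -
    have "{w..} = insert w {w + 1..}" by auto
    then show ?thesis
      using measure_pmf.finite_measure_Union[of "{w}" "geo \<rho>" "{w + 1..}"]
      by (simp add: measure_pmf_single)
  qed
  then have "ennreal (?c * geo_tail w) = ennreal (?c * pmf (geo \<rho>) w) + ennreal (?c * geo_tail (w + 1))"
    using c by (simp add: distrib_left flip: ennreal_plus)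
  ultimately show ?thesis
    by (simp add: ennreal_add_left_cancel add.commute[of _ "ennreal (_ * geo_tail (w + 1))"])
qed

end

subsection \<open>From patterns to configurations\<close>

text \<open>A list entry is a mark together with the distance to the next point; the position after
  the last distance is not included.\<close>

fun marked_points :: "int \<Rightarrow> (int \<times> int) list \<Rightarrow> (int \<times> int) set" where
  "marked_points x [] = {}"
| "marked_points x ((k, \<delta>) # l) = insert (x, k) (marked_points (x + \<delta>) l)"

lemma marked_points_pattern:
  assumes "pattern (\<lambda>n. (t n, a (n + 1) - a n)) n l"
  shows "marked_points (a n) l = (\<lambda>j. (a j, t j)) ` {n..<n + int (length l)}"
  using assms
proof (induction l arbitrary: n)
  case (Cons x l)
  then have x: "x = (t n, a (n + 1) - a n)" by simp
  have "{n..<n + int (length (x # l))} = insert n {n + 1..<n + 1 + int (length l)}" by auto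
  then show ?case using Cons.IH[of "n + 1"] Cons.prems by (simp add: x)
qed simp

lemma strict_mono_int_ge:
  fixes a :: "int \<Rightarrow> int"
  assumes "strict_mono a" "n \<le> j"
  shows "a n + (j - n) \<le> a j"
  using assms(2)
proof (induction j rule: int_ge_induct)
  case (step j)
  then show ?case using strict_monoD[OF assms(1), of j "j + 1"] by simp
qed simp

lemma measurable_configuration:
  assumes [measurable]: "\<And>n. X n \<in> M \<rightarrow>\<^sub>M count_space UNIV" "\<And>n. t n \<in> M \<rightarrow>\<^sub>M count_space UNIV"
  shows "(\<lambda>\<omega>. configuration (\<lambda>n. X n \<omega>) (\<lambda>n. t n \<omega>)) \<in> M \<rightarrow>\<^sub>M configuration_space"
  unfolding configuration_space_def
proof (rule measurable_measure_of)
  fix S :: "(int \<times> int) set set" assume "S \<in> range (\<lambda>x. {C. x \<in> C})"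
  then obtain x k where S: "S = {C. (x, k) \<in> C}" by auto
  have "(\<lambda>\<omega>. configuration (\<lambda>n. X n \<omega>) (\<lambda>n. t n \<omega>)) -` S \<inter> space M =
      {\<omega> \<in> space M. \<exists>n. X n \<omega> = x \<and> t n \<omega> = k}"
    by (auto simp: S configuration_def)
  also have "\<dots> \<in> sets M" by measurable
  finally show "(\<lambda>\<omega>. configuration (\<lambda>n. X n \<omega>) (\<lambda>n. t n \<omega>)) -` S \<inter> space M \<in> sets M" .
qed auto

text \<open>Writes inclusion probabilities as one fixed functional of the pattern counts, so
  processes with equal counts have equal inclusion probabilities. As points are at least 1 apart, N
  points starting from the leftmost site x cover all sites of F.\<close>

lemma emeasure_subset_configuration:
  fixes X t :: "int \<Rightarrow> 'a \<Rightarrow> int"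
  assumes [measurable]: "\<And>n. X n \<in> M \<rightarrow>\<^sub>M count_space UNIV" "\<And>n. t n \<in> M \<rightarrow>\<^sub>M count_space UNIV"
    and mono: "AE \<omega> in M. strict_mono (\<lambda>n. X n \<omega>)"
    and F: "finite F" "F \<noteq> {}"
    and x: "x = Min (fst ` F)" and N: "N = nat (Max (fst ` F) - x) + 1"
  shows "emeasure M {\<omega> \<in> space M. F \<subseteq> configuration (\<lambda>n. X n \<omega>) (\<lambda>n. t n \<omega>)} =
    (\<integral>\<^sup>+ l. of_bool (length l = N \<and> F \<subseteq> marked_points x l) *
      expected_count M (\<lambda>n \<omega>. X n \<omega> = x \<and> pattern (\<lambda>n. (t n \<omega>, X (n + 1) \<omega> - X n \<omega>)) n l)
      \<partial>count_space UNIV)"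
proof -
  let ?C = "\<lambda>\<omega>. configuration (\<lambda>n. X n \<omega>) (\<lambda>n. t n \<omega>)"
  let ?z = "\<lambda>n \<omega>. (t n \<omega>, X (n + 1) \<omega> - X n \<omega>)"
  let ?l = "\<lambda>n \<omega>. map (\<lambda>i. ?z (n + int i) \<omega>) [0..<N]"
  have [measurable]: "Measurable.pred M (\<lambda>\<omega>. F \<subseteq> ?C \<omega>)"
  proof -
    have "(\<lambda>\<omega>. F \<subseteq> ?C \<omega>) = (\<lambda>\<omega>. \<forall>y\<in>F. \<exists>n. X n \<omega> = fst y \<and> t n \<omega> = snd y)"
      by (force simp: configuration_def fun_eq_iff subset_eq)
    then show ?thesis using F(1) by simp
  qed
  have meas_l [measurable]: "?l n \<in> M \<rightarrow>\<^sub>M count_space UNIV" for n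
    by measurable
  have [measurable]: "Measurable.pred M (\<lambda>\<omega>. F \<subseteq> marked_points x (?l n \<omega>))" for n
    using measurable_compose[OF meas_l measurable_count_space, of "\<lambda>l. F \<subseteq> marked_points x l"] .
  \<comment> \<open>A configuration containing F has a point at x; strict monotonicity makes its
    index unique, so the probability is a count.\<close>
  have "Min (fst ` F) \<in> fst ` F" by (rule Min_in) (use F in auto)
  then obtain k where "(x, k) \<in> F" by (auto simp: x)
  then have "{\<omega> \<in> space M. F \<subseteq> ?C \<omega>} = {\<omega> \<in> space M. \<exists>n. X n \<omega> = x \<and> F \<subseteq> ?C \<omega>}"
    by (auto simp: configuration_def)
  also have "emeasure M \<dots> = expected_count M (\<lambda>n \<omega>. X n \<omega> = x \<and> F \<subseteq> ?C \<omega>)"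
  proof (rule expected_count_unique[symmetric])
    show "AE \<omega> in M. \<forall>n m. X n \<omega> = x \<and> F \<subseteq> ?C \<omega> \<longrightarrow> X m \<omega> = x \<and> F \<subseteq> ?C \<omega> \<longrightarrow> n = m"
      using mono by eventually_elim (metis strict_mono_eq)
  qed measurable
  also have "\<dots> = expected_count M (\<lambda>n \<omega>. X n \<omega> = x \<and> F \<subseteq> marked_points x (?l n \<omega>))"
  proof (rule expected_count_cong_AE)
    show "AE \<omega> in M. \<forall>n. (X n \<omega> = x \<and> F \<subseteq> ?C \<omega>) = (X n \<omega> = x \<and> F \<subseteq> marked_points x (?l n \<omega>))"
      using mono
    proof eventually_elim
      case (elim \<omega>)
      show ?case
      proof (intro allI conj_cong refl)
        fix n assume n: "X n \<omega> = x"
        have "pattern (\<lambda>n. ?z n \<omega>) n (?l n \<omega>)" by (simp add: pattern_iff_map)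
        from marked_points_pattern[OF this]
        have eq: "marked_points x (?l n \<omega>) = (\<lambda>j. (X j \<omega>, t j \<omega>)) ` {n..<n + int N}"
          by (simp add: n)
        have "y \<in> (\<lambda>j. (X j \<omega>, t j \<omega>)) ` {n..<n + int N}" if y: "y \<in> F" "y \<in> ?C \<omega>" for y
        proof -
          obtain j where j: "y = (X j \<omega>, t j \<omega>)" using y(2) by (auto simp: configuration_def)
          have "X j \<omega> \<in> fst ` F" using y(1) j by force
          then have le: "x \<le> X j \<omega>" "X j \<omega> \<le> Max (fst ` F)" using F by (auto simp: x)
          have "n \<le> j" using le(1) n strict_mono_less_eq[OF elim, of n j] by simp
          moreover have "j < n + int N"
            using strict_mono_int_ge[OF elim \<open>n \<le> j\<close>] le n by (simp add: N)
          ultimately show ?thesis using j by auto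
        qed
        then show "F \<subseteq> ?C \<omega> \<longleftrightarrow> F \<subseteq> marked_points x (?l n \<omega>)"
          unfolding eq configuration_def by blast
      qed
    qed
  qed measurable
  also have "\<dots> = (\<integral>\<^sup>+ l. expected_count M (\<lambda>n \<omega>. (X n \<omega> = x \<and> F \<subseteq> marked_points x (?l n \<omega>)) \<and> ?l n \<omega> = l)
      \<partial>count_space UNIV)"
    by (rule expected_count_partition) measurable
  also have "\<dots> = (\<integral>\<^sup>+ l. expected_count M (\<lambda>n \<omega>. (length l = N \<and> F \<subseteq> marked_points x l) \<and>
      X n \<omega> = x \<and> pattern (\<lambda>n. ?z n \<omega>) n l) \<partial>count_space UNIV)"
    by (intro nn_integral_cong expected_count_cong) (auto simp: pattern_iff_map)
  finally show ?thesis by (simp only: expected_count_conj_const)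
qed

lemma sets_configuration_space_Pi_system:
  "sets configuration_space = sigma_sets UNIV ((\<lambda>F. {C. F \<subseteq> C}) ` Collect finite)"
  unfolding configuration_space_def
proof (simp, rule sigma_sets_eqI)
  fix S :: "(int \<times> int) set set" assume "S \<in> range (\<lambda>x. {C. x \<in> C})"
  then obtain x where "S = {C. {x} \<subseteq> C}" by auto
  then show "S \<in> sigma_sets UNIV ((\<lambda>F. {C. F \<subseteq> C}) ` Collect finite)"
    by (intro sigma_sets.Basic) blast
next
  fix S :: "(int \<times> int) set set" assume "S \<in> (\<lambda>F. {C. F \<subseteq> C}) ` Collect finite"
  then obtain F where F: "finite F" "S = {C. F \<subseteq> C}" by auto
  interpret sigma_algebra UNIV "sigma_sets UNIV (range (\<lambda>x :: int \<times> int. {C. x \<in> C}))"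
    by (rule sigma_algebra_sigma_sets) simp
  have "S = (if F = {} then UNIV else (\<Inter>x\<in>F. {C. x \<in> C}))" using F by auto
  also have "\<dots> \<in> sigma_sets UNIV (range (\<lambda>x. {C. x \<in> C}))"
    using F(1) top by (auto intro!: finite_INT)
  finally show "S \<in> sigma_sets UNIV (range (\<lambda>x. {C. x \<in> C}))" .
qed

text \<open>Inclusion events form a generator closed under intersection, since containing F and
  containing G means containing their union.\<close>

lemma configuration_measure_eqI:
  assumes "finite_measure P" "sets P = sets configuration_space" "sets Q = sets configuration_space"
    and eq: "\<And>F. finite F \<Longrightarrow> emeasure P {C. F \<subseteq> C} = emeasure Q {C. F \<subseteq> C}"
  shows "P = Q"
proof (rule measure_eqI_generator_eq)
  let ?E = "(\<lambda>F. {C. F \<subseteq> C}) ` Collect (finite :: (int \<times> int) set \<Rightarrow> bool)"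
  show "Int_stable ?E"
  proof (rule Int_stableI)
    fix S T assume "S \<in> ?E" "T \<in> ?E"
    then obtain F G where "finite F" "finite G" "S = {C. F \<subseteq> C}" "T = {C. G \<subseteq> C}" by auto
    then have "S \<inter> T = {C. F \<union> G \<subseteq> C}" "finite (F \<union> G)" by auto
    then show "S \<inter> T \<in> ?E" by blast
  qed
  show "sets P = sigma_sets UNIV ?E" "sets Q = sigma_sets UNIV ?E"
    using assms sets_configuration_space_Pi_system by auto
  have "UNIV = {C. {} \<subseteq> C}" by simp
  then show "range (\<lambda>_::nat. UNIV) \<subseteq> ?E" by blast
  show "emeasure P UNIV \<noteq> \<infinity>" for i :: nat
    using finite_measure.emeasure_finite[OF assms(1)] by simp
qed (use eq in auto)

section \<open>Outputs of the queue and the law of the departures\<close>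

context queue
begin

abbreviation outgoing :: "int \<Rightarrow> 'a \<Rightarrow> int \<times> int" where
  "outgoing n \<omega> \<equiv> (r n \<omega>, D (n + 1) \<omega> - D n \<omega>)"

lemma AE_D_rec: "AE \<omega> in M. \<forall>n. D (n + 1) \<omega> = max (D n \<omega>) (A (n + 1) \<omega>) + s (n + 1) \<omega>"
  using AE_bdd_above
proof eventually_elim
  case (elim \<omega>)
  show ?case
  proof
    fix n
    from departure_rec[of "\<lambda>k. A k \<omega>" "\<lambda>k. s k \<omega>" "n + 1"] elim
    show "D (n + 1) \<omega> = max (D n \<omega>) (A (n + 1) \<omega>) + s (n + 1) \<omega>" by simp
  qed
qed

lemma AE_strict_mono_D: "AE \<omega> in M. strict_mono (\<lambda>n. D n \<omega>)"
  using AE_D_rec AE_s_ge_1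
proof eventually_elim
  case (elim \<omega>)
  have step: "D n \<omega> < D (n + 1) \<omega>" for n
    using elim(1)[rule_format, of n] elim(2)[rule_format, of "n + 1"] by linarith
  have "D n \<omega> < D m \<omega>" if "n < m" for n m
    using that by (induction m rule: int_gr_induct) (use step less_trans in blast)+
  then show ?case by (rule strict_monoI)
qed

lemma AE_output_sojourn:
  "AE \<omega> in M. \<forall>n. (r n \<omega>, D (n + 1) \<omega> - D n \<omega>, sojourn (n + 1) \<omega>) = burke (sojourn n \<omega>, incoming n \<omega>)"
  using AE_D_rec
proof eventually_elim
  case (elim \<omega>)
  show ?case
  proof
    fix n
    show "(r n \<omega>, D (n + 1) \<omega> - D n \<omega>, sojourn (n + 1) \<omega>) = burke (sojourn n \<omega>, incoming n \<omega>)"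
      using elim[rule_format, of n] by (simp add: burke_def dual_departure_def) linarith
  qed
qed

text \<open>The core of Burke's theorem: past outputs, the current sojourn time and future inputs
  carry a product weight. The induction appends outputs at the end, each time trading an input for
  an output through \<open>burke\<close>.\<close>

lemma expected_count_output_sojourn:
  "expected_count M (\<lambda>n \<omega>. sojourn (n + int (length l)) \<omega> = w \<and> (D n \<omega> = x \<and> pattern (\<lambda>n. outgoing n \<omega>) n l) \<and>
      pattern (\<lambda>n. incoming n \<omega>) (n + int (length l)) l') =
    ennreal (p * (\<Prod>y\<leftarrow>l. pmf (pair_pmf (geo q) (geo p)) y) * (\<Prod>y\<leftarrow>l'. pmf R y) * pmf (geo \<rho>) w)"
proof (induction l arbitrary: w l' rule: rev_induct)
  case Nil
  \<comment> \<open>Given the sojourn time w, a departure at x is an arrival at x - w, and the count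
    for arrivals is the same at every position.\<close>
  have "expected_count M (\<lambda>n \<omega>. sojourn n \<omega> = w \<and> D n \<omega> = x \<and> pattern (\<lambda>n. incoming n \<omega>) n l') =
    expected_count M (\<lambda>n \<omega>. sojourn n \<omega> = w \<and> A n \<omega> = x - w \<and> pattern (\<lambda>n. incoming n \<omega>) n l')"
    by (rule expected_count_cong) auto
  then show ?case by (simp add: expected_count_sojourn)
next
  case (snoc y l)
  obtain k \<delta> where y: "y = (k, \<delta>)" by (cases y)
  \<comment> \<open>Since \<open>burke\<close> is a bijection, the last output and the new sojourn
    time determine the earlier sojourn time w0 and the input (\<alpha>, \<sigma>) that produced
    them.\<close>
  obtain w0 \<alpha> \<sigma> where inv: "burke_inv (k, \<delta>, w) = (w0, \<alpha>, \<sigma>)" by (cases "burke_inv (k, \<delta>, w)")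
  then have b: "burke (w0, \<alpha>, \<sigma>) = (k, \<delta>, w)" by (metis burke_burke_inv)
  have "expected_count M (\<lambda>n \<omega>. sojourn (n + int (length (l @ [y]))) \<omega> = w \<and>
      (D n \<omega> = x \<and> pattern (\<lambda>n. outgoing n \<omega>) n (l @ [y])) \<and>
      pattern (\<lambda>n. incoming n \<omega>) (n + int (length (l @ [y]))) l') =
    expected_count M (\<lambda>n \<omega>. sojourn (n + int (length l)) \<omega> = w0 \<and>
      (D n \<omega> = x \<and> pattern (\<lambda>n. outgoing n \<omega>) n l) \<and>
      pattern (\<lambda>n. incoming n \<omega>) (n + int (length l)) ((\<alpha>, \<sigma>) # l'))"
    (is "expected_count M ?E = expected_count M ?E'")
  proof (rule expected_count_cong_AE)
    show "AE \<omega> in M. \<forall>n. ?E n \<omega> = ?E' n \<omega>"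
      using AE_output_sojourn
    proof eventually_elim
      case (elim \<omega>)
      show ?case
      proof
        fix n
        define m where "m = n + int (length l)"
        have "(r m \<omega>, D (m + 1) \<omega> - D m \<omega>, sojourn (m + 1) \<omega>) = (k, \<delta>, w) \<longleftrightarrow>
            (sojourn m \<omega>, incoming m \<omega>) = (w0, \<alpha>, \<sigma>)"
          unfolding elim[rule_format] b[symmetric] by (metis burke_inv_burke)
        then have iff: "(r m \<omega> = k \<and> D (m + 1) \<omega> - D m \<omega> = \<delta>) \<and> sojourn (m + 1) \<omega> = w \<longleftrightarrow>
            sojourn m \<omega> = w0 \<and> gap m \<omega> = \<alpha> \<and> s (m + 1) \<omega> = \<sigma>"
          by (simp only: prod.inject conj_assoc)
        have len: "n + int (length (l @ [(k, \<delta>)])) = m + 1" by (simp add: m_def)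
        show "?E n \<omega> = ?E' n \<omega>"
          unfolding y len pattern_append pattern_Cons m_def[symmetric] prod.inject
          using iff by auto
      qed
    qed
  qed measurable
  also have "\<dots> = ennreal (p * (\<Prod>y\<leftarrow>l. pmf (pair_pmf (geo q) (geo p)) y) *
      (\<Prod>y\<leftarrow>(\<alpha>, \<sigma>) # l'. pmf R y) * pmf (geo \<rho>) w0)"
    by (rule snoc.IH)
  also have "p * (\<Prod>y\<leftarrow>l. pmf (pair_pmf (geo q) (geo p)) y) * (\<Prod>y\<leftarrow>(\<alpha>, \<sigma>) # l'. pmf R y) * pmf (geo \<rho>) w0 =
      p * (\<Prod>y\<leftarrow>l @ [y]. pmf (pair_pmf (geo q) (geo p)) y) * (\<Prod>y\<leftarrow>l'. pmf R y) * pmf (geo \<rho>) w"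
  proof -
    have "pmf (geo q) k * (pmf (geo p) \<delta> * pmf (geo \<rho>) w) = pmf (geo \<rho>) w0 * (pmf (geo p) \<alpha> * pmf (geo q) \<sigma>)"
      using burke_weight[of "(w0, \<alpha>, \<sigma>)"] by (simp add: b pmf_pair)
    then show ?thesis by (simp add: y pmf_pair ac_simps)
  qed
  finally show ?case .
qed

lemma expected_count_output:
  "expected_count M (\<lambda>n \<omega>. D n \<omega> = x \<and> pattern (\<lambda>n. outgoing n \<omega>) n l) =
    ennreal (p * (\<Prod>y\<leftarrow>l. pmf (pair_pmf (geo q) (geo p)) y))"
  using expected_count_Collect[where S=UNIV and f="\<lambda>n. sojourn (n + int (length l))" and M=M
    and P="geo \<rho>" and E="\<lambda>n \<omega>. D n \<omega> = x \<and> pattern (\<lambda>n. outgoing n \<omega>) n l"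
    and c="p * (\<Prod>y\<leftarrow>l. pmf (pair_pmf (geo q) (geo p)) y)"]
    expected_count_output_sojourn[where l'="[]"] p0
  by simp

text \<open>The same weight as in \<open>expected_count_output\<close>, with services as marks and
  arrival gaps as distances: input and output have equal pattern counts.\<close>

lemma expected_count_arrivals:
  "expected_count M (\<lambda>n \<omega>. A n \<omega> = x \<and> pattern (\<lambda>n. (s n \<omega>, gap n \<omega>)) n l) =
    ennreal (p * (\<Prod>y\<leftarrow>l. pmf (pair_pmf (geo q) (geo p)) y))"
proof -
  have "(\<Prod>\<alpha>\<leftarrow>map snd l. pmf (geo p) \<alpha>) * (\<Prod>k\<leftarrow>map fst l. pmf (geo q) k) =
      (\<Prod>y\<leftarrow>l. pmf (pair_pmf (geo q) (geo p)) y)"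
    by (induction l) (auto simp: pmf_pair)
  then show ?thesis
    using expected_count_gaps_services[of x "map snd l" "map fst l"]
    by (simp add: pattern_Pair ac_simps)
qed

lemma configuration_law_eq:
  "distr M configuration_space (\<lambda>\<omega>. configuration (\<lambda>n. D n \<omega>) (\<lambda>n. r n \<omega>)) =
    distr M configuration_space (\<lambda>\<omega>. configuration (\<lambda>n. A n \<omega>) (\<lambda>n. s n \<omega>))"
proof (rule configuration_measure_eqI)
  have meas: "(\<lambda>\<omega>. configuration (\<lambda>n. D n \<omega>) (\<lambda>n. r n \<omega>)) \<in> M \<rightarrow>\<^sub>M configuration_space"
      "(\<lambda>\<omega>. configuration (\<lambda>n. A n \<omega>) (\<lambda>n. s n \<omega>)) \<in> M \<rightarrow>\<^sub>M configuration_space"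
    by (rule measurable_configuration; measurable)+
  show "finite_measure (distr M configuration_space (\<lambda>\<omega>. configuration (\<lambda>n. D n \<omega>) (\<lambda>n. r n \<omega>)))"
    by (rule finite_measure_distr[OF meas(1)])
  fix F :: "(int \<times> int) set" assume F: "finite F"
  have "{C. F \<subseteq> C} \<in> sets configuration_space"
    unfolding sets_configuration_space_Pi_system using F by (intro sigma_sets.Basic) auto
  then have distr: "emeasure (distr M configuration_space f) {C. F \<subseteq> C} = emeasure M {\<omega> \<in> space M. F \<subseteq> f \<omega>}"
    if "f \<in> M \<rightarrow>\<^sub>M configuration_space" for f
    using that by (simp add: emeasure_distr vimage_def Int_def conj_commute)
  show "emeasure (distr M configuration_space (\<lambda>\<omega>. configuration (\<lambda>n. D n \<omega>) (\<lambda>n. r n \<omega>))) {C. F \<subseteq> C} =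
    emeasure (distr M configuration_space (\<lambda>\<omega>. configuration (\<lambda>n. A n \<omega>) (\<lambda>n. s n \<omega>))) {C. F \<subseteq> C}"
  \<comment> \<open>An empty F has no leftmost site to count from; there both sides are the total
    mass.\<close>
  proof (cases "F = {}")
    case False
    show ?thesis
      unfolding distr[OF meas(1)] distr[OF meas(2)]
        emeasure_subset_configuration[OF _ _ AE_strict_mono_D F False refl refl, OF measurable_departure measurable_r,
          OF measurable_A measurable_s]
        emeasure_subset_configuration[OF _ _ mono_A F False refl refl, OF measurable_A measurable_s]
        expected_count_output expected_count_arrivals ..
  next
    case True
    show ?thesis unfolding distr[OF meas(1)] distr[OF meas(2)] by (simp add: True)
  qed
qed simp_all

end

theorem theorem2:
  fixes M :: "'a measure" and p q :: real
    and A s D r :: "int \<Rightarrow> 'a \<Rightarrow> int"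
  assumes M: "prob_space M"
    and p: "0 < p" "p < 1" and q: "0 < q" "q < 1" and pq: "p < q"
    and A_bernoulli: "bernoulli_point_process M p (\<lambda>\<omega>. range (\<lambda>n. A n \<omega>))"
    and A_numbering: "AE \<omega> in M. strict_mono (\<lambda>n. A n \<omega>) \<and> A 0 \<omega> \<le> 0 \<and> 0 < A 1 \<omega>"
    and s_indep: "prob_space.indep_vars M (\<lambda>_. count_space UNIV) s UNIV"
    and s_law: "\<And>n k. 1 \<le> k \<Longrightarrow>
      measure M {\<omega> \<in> space M. s n \<omega> = int k} = (1 - q) ^ (k - 1) * q"
    and A_s_indep: "prob_space.indep_var M
      (\<Pi>\<^sub>M n\<in>UNIV. count_space UNIV) (\<lambda>\<omega> n. A n \<omega>)
      (\<Pi>\<^sub>M n\<in>UNIV. count_space UNIV) (\<lambda>\<omega> n. s n \<omega>)"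
    and D: "\<And>n \<omega>. D n \<omega> = departure (\<lambda>k. A k \<omega>) (\<lambda>k. s k \<omega>) n"
    and r: "\<And>n \<omega>. r n \<omega> = dual_departure (\<lambda>k. A k \<omega>) (\<lambda>k. s k \<omega>) n"
  shows "(AE \<omega> in M. \<forall>n. bdd_above ((\<lambda>k. A k \<omega> + (\<Sum>i=k..n. s i \<omega>)) ` {..n})) \<and>
    (\<lambda>\<omega>. configuration (\<lambda>n. A n \<omega>) (\<lambda>n. s n \<omega>)) \<in> M \<rightarrow>\<^sub>M configuration_space \<and>
    (\<lambda>\<omega>. configuration (\<lambda>n. D n \<omega>) (\<lambda>n. r n \<omega>)) \<in> M \<rightarrow>\<^sub>M configuration_space \<and>
    distr M configuration_space (\<lambda>\<omega>. configuration (\<lambda>n. D n \<omega>) (\<lambda>n. r n \<omega>)) =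
      distr M configuration_space (\<lambda>\<omega>. configuration (\<lambda>n. A n \<omega>) (\<lambda>n. s n \<omega>))"
proof -
  interpret prob_space M by fact
  have mono_A: "AE \<omega> in M. strict_mono (\<lambda>n. A n \<omega>)"
    using A_numbering by eventually_elim simp
  interpret queue M p q A s
    by unfold_locales (fact assms mono_A)+
  show ?thesis
    unfolding D r
    using AE_bdd_above[unfolded departure_candidates_def] configuration_law_eq
    by (intro conjI measurable_configuration) measurable
qed

end
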